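(* Let $m\in\mathbb N$, let $Q,B$ be real $m\times m$ matrices with $Q=Q^\star\ge 0$, and suppose that $Q(t)=\int_0^t e^{\sigma B}Qe^{\sigma B^\star}\,d\sigma$ is positive definite for every $t>0$. For $t>0$ and $\varphi\in\mathscr S(\mathbb R^m)$ define $$\mathcal T(t)\varphi(x)=(4\pi)^{-\frac m2}\,\frac{e^{-\frac{i\pi m}{4}}}{\sqrt{\det Q(t)}}\int_{\mathbb R^m}e^{\,i\,\frac{\langle Q(t)^{-1}(y-e^{tB}x),\,y-e^{tB}x\rangle}{4}}\varphi(y)\,dy .$$ Then for every $\varphi\in\mathscr S(\mathbb R^m)$ and every $s,t>0$ one has $$\mathcal T(s+t)\varphi=\mathcal T(s)(\mathcal T(t)\varphi).$$
   Context: $\mathscr S(\mathbb R^m)$ is the Schwartz space of complex-valued functions on $\mathbb R^m$; $^\star$ denotes transpose; $\langle\cdot,\cdot\rangle$ is the (bilinear) Euclidean product; $i^2=-1$. The operators $\mathcal T(t)$ map $\mathscr S(\mathbb R^m)$ into itself. *)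

theory Defs
  imports "HOL-Analysis.Analysis"
begin

text \<open>
  The library has no exponential for the type \<open>real ^ 'm ^ 'm\<close>: there, \<open>*\<close> is the componentwise
  product, so powers have to be taken with respect to \<open>**\<close>.
\<close>

definition matrix_power :: "real ^ 'm ^ 'm \<Rightarrow> nat \<Rightarrow> real ^ 'm ^ 'm" where
  "matrix_power A k = (((**) A) ^^ k) (mat 1)"

definition matrix_exp :: "real ^ 'm ^ 'm \<Rightarrow> real ^ 'm ^ 'm" where
  "matrix_exp A = (\<Sum>k. (1 / fact k) *\<^sub>R matrix_power A k)"

text \<open>The two predicates below constrain the quadratic form only; symmetry is a separate condition.\<close>

definition pos_semidef :: "real ^ 'm ^ 'm \<Rightarrow> bool" where
  "pos_semidef A \<longleftrightarrow> (\<forall>x. 0 \<le> (A *v x) \<bullet> x)"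

definition pos_def :: "real ^ 'm ^ 'm \<Rightarrow> bool" where
  "pos_def A \<longleftrightarrow> (\<forall>x. x \<noteq> 0 \<longrightarrow> 0 < (A *v x) \<bullet> x)"

definition partial_deriv :: "'m \<Rightarrow> (real ^ 'm \<Rightarrow> complex) \<Rightarrow> real ^ 'm \<Rightarrow> complex" where
  "partial_deriv i f x = vector_derivative (\<lambda>h. f (x + h *\<^sub>R axis i 1)) (at 0)"

text \<open>
  The list \<open>[i\<^sub>1, \<dots>, i\<^sub>k]\<close> encodes the iterated derivative \<open>\<partial>\<^bsub>i\<^sub>1\<^esub> \<dots> \<partial>\<^bsub>i\<^sub>k\<^esub>\<close>. On smooth functions the
  order is irrelevant, so lists yield exactly the derivatives indexed by multi-indices.
\<close>

definition iter_partial :: "'m list \<Rightarrow> (real ^ 'm \<Rightarrow> complex) \<Rightarrow> real ^ 'm \<Rightarrow> complex" where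
  "iter_partial is f = foldr partial_deriv is f"

text \<open>
  Total differentiability of every iterated partial derivative supplies both the existence and the
  continuity of the partial derivatives of all orders, i.e. smoothness.
\<close>

definition smooth :: "(real ^ 'm \<Rightarrow> complex) \<Rightarrow> bool" where
  "smooth f \<longleftrightarrow> (\<forall>is. iter_partial is f differentiable_on UNIV)"

definition schwartz :: "(real ^ 'm \<Rightarrow> complex) set" where
  "schwartz = {f. smooth f \<and>
     (\<forall>(\<alpha> :: 'm \<Rightarrow> nat) is.
        bounded (range (\<lambda>x. complex_of_real (\<Prod>j\<in>UNIV. (x $ j) ^ \<alpha> j) * iter_partial is f x)))}"

definition Qt :: "real ^ 'm ^ 'm \<Rightarrow> real ^ 'm ^ 'm \<Rightarrow> real \<Rightarrow> real ^ 'm ^ 'm" where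
  "Qt Q B t =
     integral {0..t} (\<lambda>\<sigma>. matrix_exp (\<sigma> *\<^sub>R B) ** Q ** matrix_exp (\<sigma> *\<^sub>R transpose B))"

definition T_op ::
  "real ^ 'm ^ 'm \<Rightarrow> real ^ 'm ^ 'm \<Rightarrow> real \<Rightarrow> (real ^ 'm \<Rightarrow> complex) \<Rightarrow> real ^ 'm \<Rightarrow> complex" where
  "T_op Q B t \<phi> x =
     complex_of_real ((4 * pi) powr (- real CARD('m) / 2))
     * (exp (- (\<i> * complex_of_real pi * of_nat CARD('m) / 4))
        / complex_of_real (sqrt (det (Qt Q B t))))
     * (LINT y|lborel.
          exp (\<i> * complex_of_real
                 ((matrix_inv (Qt Q B t) *v (y - matrix_exp (t *\<^sub>R B) *v x))
                    \<bullet> (y - matrix_exp (t *\<^sub>R B) *v x)) / 4)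
          * \<phi> y)"

end

theory Submission
  imports Defs
    "HOL-Probability.Characteristic_Functions"
    "HOL-Probability.Sinc_Integral"
    "HOL-Complex_Analysis.Conformal_Mappings"
begin

text \<open>
  Write \<open>E(t) = e\<^bsup>tB\<^esup>\<close>. Up to a constant, \<open>T(t)\<phi>(x)\<close> is the value at \<open>E(t)x\<close> of the convolution of \<open>\<phi>\<close>
  with the oscillating Gaussian \<open>exp(i\<langle>Q(t)\<^sup>-\<^sup>1w,w\<rangle>/4)\<close>. Such kernels behave like Gaussian densities with
  covariance \<open>Q(t)\<close>: convolving them adds the covariances, and transporting one by \<open>E\<close> turns the
  covariance \<open>C\<close> into \<open>E C E\<^sup>\<star>\<close>. Hence the semigroup law reduces to
  \<open>Q(s+t) = Q(t) + E(t) Q(s) E(t)\<^sup>\<star>\<close> (\<open>Qt_add\<close>), which is the additivity of the integral together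
  with \<open>E(s+t) = E(t) E(s)\<close>.
  
  The only difficulty is analytic: the kernels have modulus one, so the double integral in
  \<open>T(s)(T(t)\<phi>)\<close> does not in general converge absolutely and Fubini's theorem does not apply to it. Two
  facts overcome this. Put \<open>A = Q(t)\<close> and \<open>P = E(t) Q(s) E(t)\<^sup>\<star>\<close>.
  
  \<^item> The inner convolution is integrable (\<open>integrable_phase_transform\<close>). Multiplying its value at \<open>v\<close> by
    \<open>1 + \<xi>\<^sub>j\<^sup>2\<close>, where \<open>\<xi> = A\<^sup>-\<^sup>1v/2\<close>, amounts by two integrations by parts to replacing \<open>\<phi>\<close> by another
    rapidly decreasing function, and doing so for every coordinate gives the integrable bound
    \<open>C \<Prod>\<^sub>j (1 + \<xi>\<^sub>j\<^sup>2)\<^sup>-\<^sup>1\<close>.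
  
  \<^item> Therefore the outer integrand may be damped by \<open>e\<^bsup>-\<delta>\<langle>Mv,v\<rangle>/4\<^esup>\<close> and \<open>\<delta>\<close> sent to \<open>0\<close> by dominated
    convergence (\<open>phase_convolution\<close>). For \<open>\<delta> > 0\<close> Fubini applies, and for the choice
    \<open>M = P\<^sup>-\<^sup>1 + A\<^sup>-\<^sup>1\<close> the integral over the intermediate variable is a Fourier transform of a Gaussian with the
    complex parameter \<open>\<kappa> = \<delta> - i\<close> (\<open>integral_gauss_cart\<close>). It is bounded uniformly in \<open>\<delta>\<close>, because
    \<open>Re (1/\<kappa>) \<ge> 0\<close>, so that the remaining integral against \<open>\<phi>\<close> also converges.
  
  The Gaussian formula is known for \<open>\<kappa> > 0\<close>, extends to \<open>Re \<kappa> > 0\<close> by analytic continuation, and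
  passes to several variables by diagonalising \<open>M\<close> as a quadratic form.
\<close>

section \<open>Positive definite matrices\<close>

lemma pos_def_imp_invertible:
  fixes A :: "real ^ 'm ^ 'm"
  assumes "pos_def A"
  shows "invertible A"
proof -
  have "x = 0" if "A *v x = 0" for x
    using assms that unfolding pos_def_def by (metis inner_zero_left less_irrefl)
  then have "\<exists>B. B ** A = mat 1"
    by (simp add: matrix_left_invertible_ker)
  then show ?thesis
    by (simp add: invertible_left_inverse)
qed

lemma matrix_inv_mult:
  fixes A :: "real ^ 'm ^ 'm"
  assumes "invertible A"
  shows "A ** matrix_inv A = mat 1" "matrix_inv A ** A = mat 1"
  using assms unfolding invertible_def matrix_inv_def by (metis (mono_tags, lifting) someI_ex)+

lemma matrix_inv_unique_real:
  fixes A :: "real ^ 'm ^ 'm"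
  assumes "A ** C = mat 1"
  shows "matrix_inv A = C"
proof -
  have "invertible A"
    using assms invertible_right_inverse by blast
  then have "matrix_inv A = matrix_inv A ** (A ** C)"
    using assms by simp
  also have "\<dots> = C"
    using matrix_inv_mult[OF \<open>invertible A\<close>] by (simp add: matrix_mul_assoc)
  finally show ?thesis .
qed

lemma matrix_inv_mult_vec:
  fixes A :: "real ^ 'm ^ 'm"
  assumes "invertible A"
  shows "A *v (matrix_inv A *v x) = x" "matrix_inv A *v (A *v x) = x"
  using matrix_inv_mult[OF assms] by (simp_all add: matrix_vector_mul_assoc)

lemma transpose_matrix_inv:
  fixes A :: "real ^ 'm ^ 'm"
  assumes "invertible A"
  shows "transpose (matrix_inv A) = matrix_inv (transpose A)"
  by (rule matrix_inv_unique_real[symmetric])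
    (simp add: matrix_transpose_mul[symmetric] matrix_inv_mult[OF assms])

lemma inner_mult_vec_transpose:
  fixes A :: "real ^ 'n ^ 'm"
  shows "(A *v x) \<bullet> y = x \<bullet> (transpose A *v y)"
  by (metis dot_lmul_matrix inner_commute transpose_matrix_vector transpose_transpose)

lemma inner_mult_vec_symmetric:
  fixes A :: "real ^ 'm ^ 'm"
  assumes "transpose A = A"
  shows "(A *v x) \<bullet> y = (A *v y) \<bullet> x"
  by (metis assms inner_commute inner_mult_vec_transpose)

lemma pos_def_matrix_inv:
  fixes A :: "real ^ 'm ^ 'm"
  assumes "pos_def A"
  shows "pos_def (matrix_inv A)"
  unfolding pos_def_def
proof (intro allI impI)
  fix x :: "real ^ 'm" assume "x \<noteq> 0"
  let ?y = "matrix_inv A *v x"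
  have y: "A *v ?y = x"
    using matrix_inv_mult_vec pos_def_imp_invertible[OF assms] by blast
  with \<open>x \<noteq> 0\<close> have "?y \<noteq> 0" by auto
  then have "0 < (A *v ?y) \<bullet> ?y"
    using assms by (simp add: pos_def_def)
  then show "0 < ?y \<bullet> x"
    by (simp add: y inner_commute)
qed

lemma pos_def_add:
  fixes A P :: "real ^ 'm ^ 'm"
  assumes "pos_def A" "pos_def P"
  shows "pos_def (A + P)"
  using assms unfolding pos_def_def
  by (simp add: matrix_vector_mult_add_rdistrib inner_add_left add_pos_pos)

lemma pos_def_congruence:
  fixes P E :: "real ^ 'm ^ 'm"
  assumes "pos_def P" "invertible E"
  shows "pos_def (E ** P ** transpose E)"
  unfolding pos_def_def
proof (intro allI impI)
  fix x :: "real ^ 'm" assume "x \<noteq> 0"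
  have inv: "invertible (transpose E)"
    using assms(2) transpose_invertible by blast
  have "transpose E *v x \<noteq> 0"
    using \<open>x \<noteq> 0\<close> matrix_inv_mult_vec(2)[OF inv, of x] by force
  then have "0 < (P *v (transpose E *v x)) \<bullet> (transpose E *v x)"
    using assms(1) by (simp add: pos_def_def del: transpose_matrix_vector)
  then show "0 < ((E ** P ** transpose E) *v x) \<bullet> x"
    by (simp add: inner_mult_vec_transpose[of E] matrix_vector_mul_assoc[symmetric]
        del: transpose_matrix_vector)
qed

lemma matrix_add_rdistrib:
  fixes A B C :: "real ^ 'm ^ 'm"
  shows "(A + B) ** C = A ** C + B ** C"
  by (simp add: matrix_matrix_mult_def vec_eq_iff sum.distrib distrib_right)

text \<open>
  Gram-Schmidt for the inner product \<open>\<langle>Mx,y\<rangle>\<close>: a nonzero vector orthogonal, in the usual sense, to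
  all \<open>Mx\<close> with \<open>x\<close> in the family can be normalised and added, and it exists as long as the family
  has fewer elements than the dimension.
\<close>

lemma pos_def_orthonormal_family:
  fixes M :: "real ^ 'm ^ 'm"
  assumes M: "pos_def M" and sym: "transpose M = M"
  shows "k \<le> CARD('m) \<Longrightarrow> \<exists>X. finite X \<and> card X = k \<and>
     (\<forall>x\<in>X. \<forall>y\<in>X. (M *v x) \<bullet> y = (if x = y then 1 else 0))"
proof (induction k)
  case 0
  show ?case by (rule exI[of _ "{}"]) simp
next
  case (Suc k)
  then obtain X where X: "finite X" "card X = k"
    "\<And>x y. x \<in> X \<Longrightarrow> y \<in> X \<Longrightarrow> (M *v x) \<bullet> y = (if x = y then 1 else 0)"
    by (auto simp: Suc_le_eq)
  have "dim ((*v) M ` X) \<le> card X"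
    using X(1) by (meson card_image_le dim_le_card' finite_imageI order_trans)
  then have "dim ((*v) M ` X) < DIM(real ^ 'm)"
    using Suc.prems X(2) by simp
  then obtain w where w: "w \<noteq> 0" "\<And>y. y \<in> span ((*v) M ` X) \<Longrightarrow> orthogonal w y"
    using orthogonal_to_subspace_exists by blast
  define c where "c = (M *v w) \<bullet> w"
  have c: "c > 0" using M w by (simp add: c_def pos_def_def)
  define v where "v = (1 / sqrt c) *\<^sub>R w"
  have vv: "(M *v v) \<bullet> v = 1"
    using c by (simp add: v_def matrix_vector_mult_scaleR c_def[symmetric] field_simps)
  have xv: "(M *v x) \<bullet> v = 0" if "x \<in> X" for x
    using w(2)[OF span_base, of "M *v x"] that
    by (simp add: v_def orthogonal_def inner_commute)
  have vx: "(M *v v) \<bullet> x = 0" if "x \<in> X" for x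
    using xv[OF that] inner_mult_vec_symmetric[OF sym] by metis
  have "v \<notin> X" using vv xv by force
  then show ?case
    using X vv xv vx by (intro exI[of _ "insert v X"]) auto
qed

text \<open>
  The columns of \<open>S\<close> are an orthonormal basis for the inner product \<open>\<langle>Mx,y\<rangle>\<close>. In the variable
  \<open>w = S\<^sup>-\<^sup>1v\<close> a Gaussian with form \<open>M\<close> becomes a product of one-dimensional ones.
\<close>

lemma pos_def_congruent_to_identity:
  fixes M :: "real ^ 'm ^ 'm"
  assumes M: "pos_def M" and sym: "transpose M = M"
  obtains S :: "real ^ 'm ^ 'm" where "transpose S ** M ** S = mat 1"
proof -
  obtain X where X: "finite X" "card X = CARD('m)"
    "\<And>x y. x \<in> X \<Longrightarrow> y \<in> X \<Longrightarrow> (M *v x) \<bullet> y = (if x = y then 1 else 0)"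
    using pos_def_orthonormal_family[OF assms order_refl] by blast
  obtain e where e: "bij_betw e (UNIV :: 'm set) X"
    using X(1,2) by (metis finite bij_betw_iff_card)
  define S :: "real ^ 'm ^ 'm" where "S = (\<chi> i j. e j $ i)"
  have col: "column j S = e j" for j by (simp add: column_def S_def vec_eq_iff)
  have "(transpose S ** M ** S) $ i $ j = (mat 1 :: real ^ 'm ^ 'm) $ i $ j" for i j
  proof -
    have "(transpose S ** M ** S) $ i $ j = (transpose S ** (M ** S)) $ i $ j"
      by (simp add: matrix_mul_assoc)
    also have "\<dots> = e i \<bullet> (M *v e j)"
      by (simp add: matrix_matrix_mult_def matrix_vector_mult_def transpose_def S_def inner_vec_def)
    also have "\<dots> = (if i = j then 1 else 0)"
      using X(3)[of "e j" "e i"] e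
      by (auto simp: inner_commute bij_betw_def inj_on_def)
    finally show ?thesis by (simp add: mat_def)
  qed
  then have "transpose S ** M ** S = mat 1" by (simp add: vec_eq_iff)
  then show ?thesis by (rule that)
qed

lemma det_pos_def:
  fixes M :: "real ^ 'm ^ 'm"
  assumes "pos_def M" "transpose M = M"
  shows "det M > 0"
proof -
  obtain S :: "real ^ 'm ^ 'm" where "transpose S ** M ** S = mat 1"
    using pos_def_congruent_to_identity[OF assms] .
  from arg_cong[OF this, of det] have "(det S)\<^sup>2 * det M = 1"
    by (simp add: det_mul power2_eq_square mult_ac)
  then show ?thesis
    by (metis linorder_not_less mult_nonneg_nonpos zero_le_power2 zero_less_one)
qed

section \<open>The matrix exponential and the covariance matrices\<close>

lemma matrix_power_0: "matrix_power A 0 = mat 1"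
  and matrix_power_Suc: "matrix_power A (Suc k) = A ** matrix_power A k"
  by (simp_all add: matrix_power_def)

lemma matrix_power_add: "matrix_power A (j + k) = matrix_power A j ** matrix_power A k"
  by (induction j) (simp_all add: matrix_power_0 matrix_power_Suc matrix_mul_assoc)

lemma matrix_scaleR_mult:
  fixes A B :: "real ^ 'm ^ 'm"
  shows "(c *\<^sub>R A) ** B = c *\<^sub>R (A ** B)" "A ** (c *\<^sub>R B) = c *\<^sub>R (A ** B)"
  by (simp_all add: scalar_matrix_assoc[symmetric] matrix_scalar_ac)

lemma matrix_power_scaleR: "matrix_power (c *\<^sub>R A) k = c ^ k *\<^sub>R matrix_power A k"
  by (induction k) (simp_all add: matrix_power_0 matrix_power_Suc matrix_scaleR_mult)

lemma matrix_power_transpose: "matrix_power (transpose A) k = transpose (matrix_power A k)"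
proof (induction k)
  case (Suc k)
  have "matrix_power A k ** A = A ** matrix_power A k" for k
    by (induction k) (simp_all add: matrix_power_0 matrix_power_Suc matrix_mul_assoc[symmetric])
  with Suc show ?case
    by (simp add: matrix_power_Suc matrix_transpose_mul[symmetric])
qed (simp add: matrix_power_0)

text \<open>
  Entrywise estimates reduce the exponential to numerical power series, for which absolute
  convergence, Cauchy products and continuity are standard. The sum of all \<open>|A\<^sub>i\<^sub>j|\<close> dominates every
  row sum, which is what makes it a geometric bound.
\<close>

lemma matrix_power_entry_bound:
  fixes A :: "real ^ 'm ^ 'm"
  shows "\<exists>C\<ge>0. \<forall>k i j. \<bar>matrix_power A k $ i $ j\<bar> \<le> C ^ k"
proof -
  define C where "C = (\<Sum>i\<in>UNIV. \<Sum>j\<in>UNIV. \<bar>A $ i $ j\<bar>)"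
  have C0: "C \<ge> 0" by (simp add: C_def sum_nonneg)
  have row: "(\<Sum>l\<in>UNIV. \<bar>A $ i $ l\<bar>) \<le> C" for i
    unfolding C_def by (rule member_le_sum) (auto intro: sum_nonneg)
  have "\<bar>matrix_power A k $ i $ j\<bar> \<le> C ^ k" for k i j
  proof (induction k arbitrary: i j)
    case 0
    show ?case by (simp add: matrix_power_0 mat_def)
  next
    case (Suc k)
    have "\<bar>matrix_power A (Suc k) $ i $ j\<bar> \<le> (\<Sum>l\<in>UNIV. \<bar>A $ i $ l\<bar> * \<bar>matrix_power A k $ l $ j\<bar>)"
      by (simp add: matrix_power_Suc matrix_matrix_mult_def abs_mult[symmetric])
    also have "\<dots> \<le> (\<Sum>l\<in>UNIV. \<bar>A $ i $ l\<bar> * C ^ k)"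
      by (intro sum_mono mult_left_mono Suc.IH) auto
    also have "\<dots> \<le> C * C ^ k"
      using row C0 by (simp add: sum_distrib_right[symmetric] mult_right_mono)
    finally show ?case by simp
  qed
  with C0 show ?thesis by blast
qed

lemma summable_matrix_power_entry:
  fixes A :: "real ^ 'm ^ 'm"
  shows "summable (\<lambda>k. norm (matrix_power A k $ i $ j / fact k * t ^ k))"
proof -
  obtain C where C: "C \<ge> 0" "\<And>k i j. \<bar>matrix_power A k $ i $ j\<bar> \<le> C ^ k"
    using matrix_power_entry_bound by blast
  have "summable (\<lambda>k. inverse (fact k) * (C * \<bar>t\<bar>) ^ k)"
    by (rule summable_exp)
  moreover have "norm (norm (matrix_power A k $ i $ j / fact k * t ^ k))
      \<le> inverse (fact k) * (C * \<bar>t\<bar>) ^ k" for k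
    using mult_right_mono[OF C(2)[of k i j], of "\<bar>t\<bar> ^ k"]
    by (simp add: abs_mult power_mult_distrib power_abs divide_simps)
  ultimately show ?thesis
    by (rule summable_comparison_test'[where N = 0])
qed

lemma matrix_exp_entry_sums:
  "(\<lambda>k. matrix_power B k $ i $ j / fact k * t ^ k) sums (matrix_exp (t *\<^sub>R B) $ i $ j)"
proof -
  let ?f = "\<lambda>k. (1 / fact k) *\<^sub>R matrix_power (t *\<^sub>R B) k"
  let ?L = "\<chi> i j. \<Sum>k. matrix_power B k $ i $ j / fact k * t ^ k"
  have *: "(\<lambda>k. matrix_power B k $ i $ j / fact k * t ^ k)
      sums (\<Sum>k. matrix_power B k $ i $ j / fact k * t ^ k)" for i j
    by (intro summable_sums summable_norm_cancel[OF summable_matrix_power_entry])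
  have "?f sums ?L"
    unfolding sums_def
    by (intro vec_tendstoI) (use * in \<open>simp add: sums_def matrix_power_scaleR mult.commute\<close>)
  then have "matrix_exp (t *\<^sub>R B) = ?L"
    unfolding matrix_exp_def by (rule sums_unique[symmetric])
  with * show ?thesis by simp
qed

text \<open>
  The entries of the product are sums of Cauchy products of numerical series, in which
  \<open>matrix_power_add\<close> and the binomial theorem collect the terms of total degree \<open>k\<close>.
\<close>

lemma matrix_exp_add:
  "matrix_exp ((s + t) *\<^sub>R B) = matrix_exp (s *\<^sub>R B) ** matrix_exp (t *\<^sub>R B)"
proof -
  let ?a = "\<lambda>t i j k. matrix_power B k $ i $ j / fact k * t ^ k"
  have "matrix_exp ((s + t) *\<^sub>R B) $ i $ j
      = (matrix_exp (s *\<^sub>R B) ** matrix_exp (t *\<^sub>R B)) $ i $ j" for i j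
  proof -
    have "(\<lambda>k. \<Sum>l\<in>UNIV. \<Sum>n\<le>k. ?a s i l n * ?a t l j (k - n)) sums
        (\<Sum>l\<in>UNIV. (\<Sum>k. ?a s i l k) * (\<Sum>k. ?a t l j k))"
      by (intro sums_sum Cauchy_product_sums summable_matrix_power_entry)
    also have "(\<Sum>l\<in>UNIV. (\<Sum>k. ?a s i l k) * (\<Sum>k. ?a t l j k))
        = (matrix_exp (s *\<^sub>R B) ** matrix_exp (t *\<^sub>R B)) $ i $ j"
      by (simp only: matrix_matrix_mult_def matrix_exp_entry_sums[THEN sums_unique, symmetric]
          vec_lambda_beta)
    also have "(\<lambda>k. \<Sum>l\<in>UNIV. \<Sum>n\<le>k. ?a s i l n * ?a t l j (k - n)) = ?a (s + t) i j"
    proof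
      fix k
      have "(\<Sum>l\<in>UNIV. \<Sum>n\<le>k. ?a s i l n * ?a t l j (k - n))
        = (\<Sum>n\<le>k. s ^ n * t ^ (k - n) / (fact n * fact (k - n)) *
            (\<Sum>l\<in>UNIV. matrix_power B n $ i $ l * matrix_power B (k - n) $ l $ j))"
        by (subst sum.swap) (simp add: sum_distrib_left mult_ac)
      also have "\<dots> = (\<Sum>n\<le>k. s ^ n * t ^ (k - n) / (fact n * fact (k - n)) *
            matrix_power B k $ i $ j)"
      proof (rule sum.cong)
        fix n assume "n \<in> {..k}"
        then have "matrix_power B k = matrix_power B n ** matrix_power B (k - n)"
          by (simp add: matrix_power_add[symmetric])
        then show "s ^ n * t ^ (k - n) / (fact n * fact (k - n)) *
            (\<Sum>l\<in>UNIV. matrix_power B n $ i $ l * matrix_power B (k - n) $ l $ j)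
           = s ^ n * t ^ (k - n) / (fact n * fact (k - n)) * matrix_power B k $ i $ j"
          by (simp add: matrix_matrix_mult_def)
      qed simp
      also have "\<dots> = matrix_power B k $ i $ j / fact k *
          (\<Sum>n\<le>k. of_nat (k choose n) * s ^ n * t ^ (k - n))"
        by (simp add: sum_distrib_left binomial_fact mult_ac)
      finally show "(\<Sum>l\<in>UNIV. \<Sum>n\<le>k. ?a s i l n * ?a t l j (k - n)) = ?a (s + t) i j k"
        by (simp add: binomial_ring)
    qed
    finally show ?thesis
      using matrix_exp_entry_sums sums_unique2 by blast
  qed
  then show ?thesis by (simp add: vec_eq_iff)
qed

lemma matrix_exp_zero: "matrix_exp (0 *\<^sub>R B) = mat 1"
proof -
  have "(\<lambda>k. matrix_power B k $ i $ j / fact k * 0 ^ k) sums (matrix_power B 0 $ i $ j / fact 0)" for i j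
    using powser_sums_zero[of "\<lambda>k. matrix_power B k $ i $ j / fact k"] by simp
  then show ?thesis
    using matrix_exp_entry_sums[of B _ _ 0] sums_unique2
    by (fastforce simp: vec_eq_iff matrix_power_0)
qed

lemma invertible_matrix_exp: "invertible (matrix_exp (t *\<^sub>R B))"
  using matrix_exp_add[of t "- t" B] matrix_exp_zero[of B]
  by (metis add.right_inverse invertible_right_inverse)

lemma matrix_exp_transpose: "matrix_exp (t *\<^sub>R transpose B) = transpose (matrix_exp (t *\<^sub>R B))"
proof -
  have "matrix_exp (t *\<^sub>R transpose B) $ i $ j = matrix_exp (t *\<^sub>R B) $ j $ i" for i j
  proof -
    have "matrix_power (transpose B) k $ i $ j = matrix_power B k $ j $ i" for k
      by (simp add: matrix_power_transpose) (simp add: transpose_def)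
    then show ?thesis
      using matrix_exp_entry_sums[of "transpose B" i j t] matrix_exp_entry_sums[of B j i t]
      by (simp only: sums_unique2)
  qed
  then show ?thesis by (simp add: vec_eq_iff transpose_def)
qed

lemma continuous_on_matrix_exp: "continuous_on S (\<lambda>t. matrix_exp (t *\<^sub>R B))"
proof -
  have "isCont (\<lambda>t. matrix_exp (t *\<^sub>R B) $ i $ j) t" for i j t
  proof -
    have eq: "(\<lambda>t. matrix_exp (t *\<^sub>R B) $ i $ j) = (\<lambda>t. \<Sum>k. matrix_power B k $ i $ j / fact k * t ^ k)"
      using matrix_exp_entry_sums sums_unique by blast
    show ?thesis
      unfolding eq
      by (rule isCont_powser[where K = "\<bar>t\<bar> + 1"])
        (rule summable_norm_cancel[OF summable_matrix_power_entry], simp)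
  qed
  then have "continuous_on S (\<lambda>t. \<chi> i j. matrix_exp (t *\<^sub>R B) $ i $ j)"
    by (intro continuous_on_vec_lambda continuous_at_imp_continuous_on) auto
  then show ?thesis by (simp only: vec_nth_inverse vec_lambda_eta)
qed

lemma bounded_bilinear_matrix_mult: "bounded_bilinear ((**) :: real ^ 'm ^ 'm \<Rightarrow> real ^ 'm ^ 'm \<Rightarrow> real ^ 'm ^ 'm)"
  by (rule bilinear_conv_bounded_bilinear[THEN iffD1])
    (auto simp: bilinear_def linear_iff matrix_add_ldistrib matrix_add_rdistrib matrix_scaleR_mult)

lemma bounded_linear_transpose: "bounded_linear (transpose :: real ^ 'm ^ 'm \<Rightarrow> _)"
  by (rule linear_conv_bounded_linear[THEN iffD1])
    (auto simp: linear_iff transpose_def vec_eq_iff)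

text \<open>
  Naming the integrand lets its shift \<open>\<sigma> \<mapsto> \<sigma> + t\<close> and its symmetry be stated as identities of functions.
\<close>

definition Qt_integrand where
  "Qt_integrand Q B \<sigma> = matrix_exp (\<sigma> *\<^sub>R B) ** Q ** matrix_exp (\<sigma> *\<^sub>R transpose B)"

lemma integrable_Qt_integrand:
  fixes Q B :: "real ^ 'm ^ 'm"
  shows "Qt_integrand Q B integrable_on {a..b}"
  unfolding Qt_integrand_def[abs_def]
  by (intro integrable_continuous_interval
      bounded_bilinear.continuous_on[OF bounded_bilinear_matrix_mult]
      continuous_on_matrix_exp continuous_on_const)

lemma Qt_symmetric:
  assumes "Q = transpose Q"
  shows "transpose (Qt Q B t) = Qt Q B t"
proof -
  have "transpose (integral {0..t} (Qt_integrand Q B)) = integral {0..t} (transpose \<circ> Qt_integrand Q B)"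
    using integral_linear[OF integrable_Qt_integrand bounded_linear_transpose] by metis
  also have "transpose \<circ> Qt_integrand Q B = Qt_integrand Q B"
    using assms
    by (auto simp: Qt_integrand_def matrix_transpose_mul matrix_mul_assoc matrix_exp_transpose fun_eq_iff)
  finally show ?thesis by (simp add: Qt_def Qt_integrand_def[abs_def])
qed

text \<open>
  Split the integral over \<open>[0, s+t]\<close> at \<open>t\<close>. On the second piece the factors \<open>E(t)\<close> and \<open>E(t)\<^sup>\<star>\<close> come
  out of the integrand.
\<close>

lemma Qt_add:
  assumes "0 \<le> s" "0 \<le> t"
  shows "Qt Q B (s + t) = Qt Q B t + matrix_exp (t *\<^sub>R B) ** Qt Q B s ** transpose (matrix_exp (t *\<^sub>R B))"
proof -
  let ?E = "matrix_exp (t *\<^sub>R B)"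
  let ?L = "\<lambda>X. ?E ** X ** transpose ?E"
  have L: "bounded_linear ?L"
    by (rule linear_conv_bounded_linear[THEN iffD1])
      (auto simp: linear_iff matrix_add_ldistrib matrix_add_rdistrib matrix_scaleR_mult)
  have shift: "Qt_integrand Q B (\<sigma> + t) = ?L (Qt_integrand Q B \<sigma>)" for \<sigma>
  proof -
    have "matrix_exp ((\<sigma> + t) *\<^sub>R transpose B) = matrix_exp (\<sigma> *\<^sub>R transpose B) ** transpose ?E"
      by (simp add: matrix_exp_add matrix_exp_transpose[symmetric])
    moreover have "matrix_exp ((\<sigma> + t) *\<^sub>R B) = ?E ** matrix_exp (\<sigma> *\<^sub>R B)"
      by (simp add: matrix_exp_add[symmetric] add.commute)
    ultimately show ?thesis
      by (simp add: Qt_integrand_def matrix_mul_assoc)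
  qed
  have "integral {0..s+t} (Qt_integrand Q B)
      = integral {0..t} (Qt_integrand Q B) + integral {t..s+t} (Qt_integrand Q B)"
    using assms by (intro Henstock_Kurzweil_Integration.integral_combine[symmetric] integrable_Qt_integrand) auto
  also have "integral {t..s+t} (Qt_integrand Q B) = integral {0..s} (\<lambda>\<sigma>. Qt_integrand Q B (\<sigma> + t))"
    using integral_shift_Icc_real[of 0 s "Qt_integrand Q B" t]
    by (simp add: o_def add.commute)
  also have "\<dots> = ?L (integral {0..s} (Qt_integrand Q B))"
    unfolding shift using integral_linear[OF integrable_Qt_integrand L] by (simp add: o_def)
  finally show ?thesis by (simp add: Qt_def Qt_integrand_def[abs_def])
qed

text \<open>
  This says how a Gaussian kernel is transported by \<open>E\<close>: the inverse of \<open>E P E\<^sup>\<star>\<close> evaluated along \<open>Ez\<close>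
  agrees with the inverse of \<open>P\<close> evaluated along \<open>z\<close>.
\<close>

lemma matrix_inv_congruence:
  fixes E P :: "real ^ 'm ^ 'm"
  assumes "invertible E" "invertible P"
  shows "(matrix_inv (E ** P ** transpose E) *v (E *v z)) \<bullet> (E *v z) = (matrix_inv P *v z) \<bullet> z"
proof -
  have ET: "invertible (transpose E)" using assms(1) transpose_invertible by blast
  let ?w = "matrix_inv (transpose E) *v (matrix_inv P *v z)"
  have "(E ** P ** transpose E) *v ?w = E *v z"
    by (simp add: matrix_vector_mul_assoc[symmetric] matrix_inv_mult_vec assms ET del: transpose_matrix_vector)
  moreover have "invertible (E ** P ** transpose E)"
    by (intro invertible_mult assms ET)
  ultimately have "matrix_inv (E ** P ** transpose E) *v (E *v z) = ?w"
    using matrix_inv_mult_vec(2) by metis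
  then show ?thesis
    by (metis ET inner_commute inner_mult_vec_transpose matrix_inv_mult_vec(1))
qed

section \<open>Fourier transform of a complex Gaussian on the line\<close>

lemma norm_exp_minus_one_le: "norm (exp z - 1) \<le> norm z * exp (norm z)" for z :: complex
proof -
  have "norm (exp z - exp 0) \<le> exp (norm z) * norm (z - 0)"
  proof (rule field_differentiable_bound[where S = "cball 0 (norm z)"])
    fix w :: complex assume "w \<in> cball 0 (norm z)"
    then show "norm (exp w) \<le> exp (norm z)"
      using abs_Re_le_cmod[of w] by simp
    show "(exp has_field_derivative exp w) (at w within cball 0 (norm z))"
      by (auto intro!: derivative_eq_intros)
  qed auto
  then show ?thesis by (simp add: mult.commute)
qed

lemma integrable_moment_gaussian:
  assumes "a > 0"
  shows "integrable lborel (\<lambda>w::real. w ^ k * exp (- a * w\<^sup>2))"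
proof -
  define \<sigma> where "\<sigma> = sqrt (1 / (2 * a))"
  have s: "\<sigma> > 0" "\<sigma>\<^sup>2 = 1 / (2 * a)" using assms by (auto simp: \<sigma>_def)
  have "integrable lborel (\<lambda>w. sqrt (2 * pi * \<sigma>\<^sup>2) * (normal_density 0 \<sigma> w * (w - 0) ^ k))"
    by (intro integrable_mult_right integrable_normal_moment s)
  also have "(\<lambda>w. sqrt (2 * pi * \<sigma>\<^sup>2) * (normal_density 0 \<sigma> w * (w - 0) ^ k)) = (\<lambda>w. w ^ k * exp (- a * w\<^sup>2))"
    using assms by (auto simp: normal_density_def s fun_eq_iff)
  finally show ?thesis .
qed

definition gauss :: "real \<Rightarrow> complex \<Rightarrow> real \<Rightarrow> complex" where
  "gauss b \<kappa> w = exp (- \<kappa> / 4 * (of_real w)\<^sup>2 + \<i> * of_real (b * w))"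

lemma norm_gauss: "norm (gauss b \<kappa> w) = exp (- (Re \<kappa> / 4) * w\<^sup>2)"
  by (simp add: gauss_def power2_eq_square)

lemma borel_measurable_gauss [measurable]: "gauss b \<kappa> \<in> borel_measurable borel"
  unfolding gauss_def[abs_def] by measurable

lemma integrable_gauss:
  assumes "Re \<kappa> > 0"
  shows "integrable lborel (gauss b \<kappa>)"
  by (rule Bochner_Integration.integrable_bound[OF integrable_moment_gaussian[where a = "Re \<kappa> / 4" and k = 0]])
    (use assms in \<open>auto simp: norm_gauss\<close>)

text \<open>
  Differentiation under the integral. For \<open>|h| < r = Re \<kappa>/2\<close> the difference quotient in \<open>\<kappa>\<close> is dominated
  by \<open>w\<^sup>2/4 \<cdot> e\<^bsup>-r w\<^sup>2/4\<^esup>\<close>, since \<open>norm_exp_minus_one_le\<close> costs only half of the Gaussian decay.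
\<close>

lemma gauss_integral_has_field_derivative:
  assumes "Re \<kappa> > 0"
  shows "((\<lambda>\<kappa>. LINT w|lborel. gauss b \<kappa> w) has_field_derivative
     (LINT w|lborel. - (of_real w)\<^sup>2 / 4 * gauss b \<kappa> w)) (at \<kappa>)"
  unfolding has_field_derivative_iff tendsto_at_iff_sequentially
proof (intro allI impI)
  fix X :: "nat \<Rightarrow> complex"
  assume X0: "\<forall>i. X i \<in> UNIV - {\<kappa>}" and X: "X \<longlonglongrightarrow> \<kappa>"
  define r where "r = Re \<kappa> / 2"
  have r: "r > 0" using assms by (simp add: r_def)
  obtain N where N: "\<And>n. n \<ge> N \<Longrightarrow> norm (X n - \<kappa>) < r"
    using X r by (metis LIMSEQ_iff)
  let ?D = "\<lambda>n w. (gauss b (X (n + N)) w - gauss b \<kappa> w) / (X (n + N) - \<kappa>)"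
  have eq: "gauss b z w - gauss b \<kappa> w = gauss b \<kappa> w * (exp (- (z - \<kappa>) / 4 * (of_real w)\<^sup>2) - 1)" for z w
    by (simp add: gauss_def exp_add[symmetric] algebra_simps diff_divide_distrib)
  \<comment> \<open>Shifting the sequence by \<open>N\<close> makes the domination valid for every index.\<close>
  have "(\<lambda>n. LINT w|lborel. ?D n w) \<longlonglongrightarrow> (LINT w|lborel. - (of_real w)\<^sup>2 / 4 * gauss b \<kappa> w)"
  proof (rule integral_dominated_convergence)
    have "integrable lborel (\<lambda>w::real. (1/4) * (w\<^sup>2 * exp (- (r / 4) * w\<^sup>2)))"
      using r by (intro integrable_mult_right integrable_moment_gaussian) auto
    then show "integrable lborel (\<lambda>w::real. w\<^sup>2 / 4 * exp (- (r / 4) * w\<^sup>2))" by simp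
  next
    fix n
    show "AE w in lborel. norm (?D n w) \<le> w\<^sup>2 / 4 * exp (- (r / 4) * w\<^sup>2)"
    proof (rule AE_I2)
      fix w :: real
      define h where "h = X (n + N) - \<kappa>"
      have h: "norm h < r" "h \<noteq> 0" using N[of "n + N"] X0 by (auto simp: h_def)
      let ?z = "- h / 4 * (of_real w)\<^sup>2"
      have nz: "norm ?z = norm h / 4 * w\<^sup>2" by (simp add: norm_mult norm_power norm_divide)
      have "norm (exp ?z - 1) \<le> norm h / 4 * w\<^sup>2 * exp (norm h / 4 * w\<^sup>2)"
        using norm_exp_minus_one_le[of ?z] unfolding nz .
      also have "\<dots> \<le> norm h / 4 * w\<^sup>2 * exp (r / 4 * w\<^sup>2)"
        using h by (intro mult_left_mono) (auto intro!: mult_right_mono)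
      finally have *: "norm (exp ?z - 1) / norm h \<le> w\<^sup>2 / 4 * exp (r / 4 * w\<^sup>2)"
        using h by (simp add: field_simps)
      have "norm (?D n w) = exp (- (Re \<kappa> / 4) * w\<^sup>2) * (norm (exp ?z - 1) / norm h)"
        unfolding eq h_def[symmetric] by (simp add: norm_mult norm_divide norm_gauss)
      also have "\<dots> \<le> exp (- (Re \<kappa> / 4) * w\<^sup>2) * (w\<^sup>2 / 4 * exp (r / 4 * w\<^sup>2))"
        by (intro mult_left_mono *) auto
      also have "\<dots> = w\<^sup>2 / 4 * exp (- (r / 4) * w\<^sup>2)"
        by (simp add: r_def exp_add[symmetric] algebra_simps)
      finally show "norm (?D n w) \<le> w\<^sup>2 / 4 * exp (- (r / 4) * w\<^sup>2)" .
    qed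
  next
    show "AE w in lborel. (\<lambda>n. ?D n w) \<longlonglongrightarrow> - (of_real w)\<^sup>2 / 4 * gauss b \<kappa> w"
    proof (rule AE_I2)
      fix w :: real
      have "((\<lambda>\<kappa>. gauss b \<kappa> w) has_field_derivative - (of_real w)\<^sup>2 / 4 * gauss b \<kappa> w) (at \<kappa>)"
        unfolding gauss_def by (auto intro!: derivative_eq_intros)
      then have "(\<lambda>n. (gauss b (X n) w - gauss b \<kappa> w) / (X n - \<kappa>)) \<longlonglongrightarrow> - (of_real w)\<^sup>2 / 4 * gauss b \<kappa> w"
        using X0 X unfolding has_field_derivative_iff tendsto_at_iff_sequentially o_def by blast
      then show "(\<lambda>n. ?D n w) \<longlonglongrightarrow> - (of_real w)\<^sup>2 / 4 * gauss b \<kappa> w"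
        by (rule LIMSEQ_ignore_initial_segment)
    qed
  qed measurable
  also have "(\<lambda>n. LINT w|lborel. ?D n w) =
    (\<lambda>n. ((LINT w|lborel. gauss b (X (n + N)) w) - (LINT w|lborel. gauss b \<kappa> w)) / (X (n + N) - \<kappa>))"
  proof
    fix n
    have "\<bar>Re (X (n + N) - \<kappa>)\<bar> < r"
      using N[of "n + N"] abs_Re_le_cmod[of "X (n + N) - \<kappa>"] by linarith
    then have "Re (X (n + N)) > 0" unfolding r_def abs_less_iff minus_complex.simps using assms by argo
    then show "(LINT w|lborel. ?D n w) =
      ((LINT w|lborel. gauss b (X (n + N)) w) - (LINT w|lborel. gauss b \<kappa> w)) / (X (n + N) - \<kappa>)"
      using assms by (simp add: integrable_gauss Bochner_Integration.integral_diff)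
  qed
  finally show "((\<lambda>y. ((LINT w|lborel. gauss b y w) - (LINT w|lborel. gauss b \<kappa> w)) / (y - \<kappa>)) \<circ> X)
      \<longlonglongrightarrow> (LINT w|lborel. - (of_real w)\<^sup>2 / 4 * gauss b \<kappa> w)"
    unfolding o_def by (rule LIMSEQ_offset)
qed

text \<open>
  For real \<open>k\<close> the substitution \<open>w = \<surd>(2/k) x\<close> turns the integral into the characteristic function of
  the standard normal distribution.
\<close>

lemma gauss_integral_real:
  assumes "k > 0"
  shows "(LINT w|lborel. gauss b (of_real k) w) = csqrt (of_real (4 * pi) / of_real k) * exp (- (of_real b)\<^sup>2 / of_real k)"
proof -
  define c where "c = sqrt (2 / k)"
  have c: "c > 0" "c\<^sup>2 = 2 / k" using assms by (auto simp: c_def)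
  have "exp (- ((b * c)\<^sup>2) / 2) = char std_normal_distribution (b * c)"
    by (simp add: char_std_normal_distribution)
  also have "\<dots> = (LINT x|lborel. std_normal_density x *\<^sub>R iexp (b * c * x))"
    unfolding char_def by (subst integral_density) auto
  also have "\<dots> = (LINT x|lborel. (1 / sqrt (2 * pi)) *\<^sub>R gauss b (of_real k) (0 + c * x))"
  proof (rule Bochner_Integration.integral_cong)
    fix x :: real
    have "k * (c * x)\<^sup>2 = 2 * x\<^sup>2" using c assms by (simp add: power_mult_distrib)
    then have "of_real k * (of_real (c * x))\<^sup>2 = (2 * of_real (x\<^sup>2) :: complex)"
      by (metis of_real_mult of_real_numeral of_real_power)
    then have "- of_real k / 4 * (of_real (c * x))\<^sup>2 = (of_real (- x\<^sup>2 / 2) :: complex)"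
      by simp
    then have "gauss b (of_real k) (c * x) = exp (of_real (- x\<^sup>2 / 2)) * iexp (b * c * x)"
      unfolding gauss_def exp_add[symmetric] by (simp only: mult.assoc)
    then show "std_normal_density x *\<^sub>R iexp (b * c * x) = (1 / sqrt (2 * pi)) *\<^sub>R gauss b (of_real k) (0 + c * x)"
      by (simp add: normal_density_def scaleR_conv_of_real exp_of_real[symmetric])
  qed simp
  also have "\<dots> = (1 / sqrt (2 * pi)) *\<^sub>R (LINT x|lborel. gauss b (of_real k) (0 + c * x))"
    by simp
  also have "(LINT x|lborel. gauss b (of_real k) (0 + c * x)) = (1 / c) *\<^sub>R (LINT w|lborel. gauss b (of_real k) w)"
    using c by (subst (2) lborel_integral_real_affine[where c = c and t = 0]) auto
  finally have "(LINT w|lborel. gauss b (of_real k) w) = of_real (c * sqrt (2 * pi) * exp (- ((b * c)\<^sup>2) / 2))"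
    using c by (simp add: scaleR_conv_of_real field_simps)
  also have "c * sqrt (2 * pi) = sqrt (4 * pi / k)"
    by (simp add: c_def real_sqrt_mult[symmetric])
  also have "(b * c)\<^sup>2 = 2 * b\<^sup>2 / k" using c by (simp add: power_mult_distrib)
  finally show ?thesis using assms
    by (simp add: exp_of_real[symmetric] del: exp_of_real)
qed

text \<open>
  Both sides are holomorphic in the half plane \<open>Re \<kappa> > 0\<close>, where \<open>4\<pi>/\<kappa>\<close> avoids the cut of the
  square root, and they agree on the positive real axis.
\<close>

lemma gauss_integral:
  fixes \<kappa> :: complex
  assumes "Re \<kappa> > 0"
  shows "(LINT w|lborel. gauss b \<kappa> w) = csqrt (of_real (4 * pi) / \<kappa>) * exp (- (of_real b)\<^sup>2 / \<kappa>)"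
proof -
  let ?H = "{z. Re z > 0}"
  let ?f = "\<lambda>z. (LINT w|lborel. gauss b z w) - csqrt (of_real (4 * pi) / z) * exp (- (of_real b)\<^sup>2 / z)"
  have pos: "Re (of_real (4 * pi) / z) > 0" if "Re z > 0" for z :: complex
    using that by (auto simp: Re_divide intro!: divide_pos_pos add_pos_nonneg)
  have nonpos: "of_real (4 * pi) / z \<notin> \<real>\<^sub>\<le>\<^sub>0" if "Re z > 0" for z :: complex
    using pos[OF that] unfolding complex_nonpos_Reals_iff by linarith
  have "?f \<kappa> = 0"
  proof (rule analytic_continuation[where f = ?f and w = \<kappa> and S = ?H and U = "complex_of_real ` {0<..}" and \<xi> = 1])
    have "(\<lambda>z. LINT w|lborel. gauss b z w) holomorphic_on ?H"
      unfolding holomorphic_on_def field_differentiable_def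
      using gauss_integral_has_field_derivative has_field_derivative_at_within by blast
    moreover have "(\<lambda>z. csqrt (of_real (4 * pi) / z) * exp (- (of_real b)\<^sup>2 / z)) holomorphic_on ?H"
      by (intro holomorphic_intros; (rule nonpos)?; force)
    ultimately show "?f holomorphic_on ?H" by (rule holomorphic_on_diff)
    show "open ?H" by (rule open_halfspace_Re_gt)
    show "connected ?H" by (rule convex_connected[OF convex_halfspace_Re_gt])
    show "(1 :: complex) islimpt complex_of_real ` {0<..}"
      unfolding islimpt_sequential
    proof (intro exI conjI allI)
      fix n
      show "complex_of_real (1 + 1 / real (Suc n)) \<in> of_real ` {0<..} - {1}"
        by (intro DiffI imageI) (auto simp: add_pos_pos simp del: of_nat_Suc)
    next
      have "(\<lambda>n. complex_of_real (1 + 1 / real (Suc n))) \<longlonglongrightarrow> of_real (1 + 0)"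
        by (intro tendsto_of_real tendsto_add tendsto_const LIMSEQ_Suc[OF lim_1_over_n])
      then show "(\<lambda>n. complex_of_real (1 + 1 / real (Suc n))) \<longlonglongrightarrow> 1" by simp
    qed
    show "?f z = 0" if z: "z \<in> complex_of_real ` {0<..}" for z
    proof -
      obtain k where "z = of_real k" "k > 0" using z by auto
      then show ?thesis using gauss_integral_real[of k b] by (simp only: diff_self)
    qed
    show "\<kappa> \<in> ?H" using assms by simp
    show "complex_of_real ` {0<..} \<subseteq> ?H" by auto
    show "1 \<in> ?H" by simp
  qed
  then show ?thesis by (simp only: right_minus_eq)
qed

section \<open>Lebesgue measure on Cartesian space\<close>

lemma bij_betw_axis_Basis: "bij_betw (\<lambda>j. axis j 1 :: real ^ 'm) UNIV Basis"
  by (auto simp: bij_betw_def inj_on_def axis_eq_axis Basis_vec_def)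

lemma
  fixes f :: "'m::finite \<Rightarrow> real \<Rightarrow> 'a :: {real_normed_field, banach, second_countable_topology}"
  assumes f: "\<And>j. integrable lborel (f j)"
  shows integrable_lborel_cart_prod: "integrable lborel (\<lambda>x :: real ^ 'm. \<Prod>j\<in>UNIV. f j (x $ j))"
    and integral_lborel_cart_prod:
      "(LINT x|lborel. (\<Prod>j\<in>UNIV. f j ((x :: real ^ 'm) $ j))) = (\<Prod>j\<in>UNIV. LINT w|lborel. f j w)"
proof -
  interpret product_sigma_finite "\<lambda>_ :: real ^ 'm. lborel :: real measure" ..
  define g where "g b = f (inv (\<lambda>j. axis j 1 :: real ^ 'm) b)" for b
  have inj: "inj (\<lambda>j. axis j (1 :: real) :: real ^ 'm)"
    using bij_betw_axis_Basis by (auto simp: bij_betw_def)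
  have g: "g (axis j 1) = f j" for j
    by (simp add: g_def inv_f_f[OF inj])
  have gi: "integrable lborel (g b)" for b
    by (simp add: g_def f)
  have fm [measurable]: "f j \<in> borel_measurable borel" for j
    using borel_measurable_integrable[OF f[of j]] by simp
  have prod_eq: "(\<Prod>j\<in>UNIV. f j (x $ j)) = (\<Prod>b\<in>Basis. g b (x \<bullet> b))" for x :: "real ^ 'm"
    by (subst prod.reindex_bij_betw[OF bij_betw_axis_Basis, symmetric])
      (simp add: g inner_axis)
  have [measurable]: "(\<lambda>x :: real ^ 'm. x $ j) \<in> borel_measurable borel" for j
    by (intro borel_measurable_continuous_onI continuous_intros)
  have fprod: "(\<lambda>x. \<Prod>j\<in>UNIV. f j (x $ j)) \<in> borel_measurable borel"
    by measurable
  let ?T = "\<lambda>h. \<Sum>b\<in>Basis. h b *\<^sub>R b :: real ^ 'm"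
  have T: "?T h \<bullet> b = h b" if "b \<in> Basis" for h b
    using that by (simp add: inner_sum_left inner_Basis if_distrib sum.delta cong: if_cong)
  have *: "(\<Prod>j\<in>UNIV. f j (?T h $ j)) = (\<Prod>b\<in>Basis. g b (h b))" for h
    unfolding prod_eq by (intro prod.cong) (simp_all only: T)
  have meas: "?T \<in> borel_measurable (\<Pi>\<^sub>M b\<in>Basis. lborel)" by measurable
  have "integrable (\<Pi>\<^sub>M b\<in>Basis. lborel) (\<lambda>h. \<Prod>b\<in>Basis. g b (h b))"
    by (rule product_integrable_prod) (auto intro: gi)
  then show "integrable lborel (\<lambda>x :: real ^ 'm. \<Prod>j\<in>UNIV. f j (x $ j))"
    by (subst lborel_eq, subst integrable_distr_eq[OF meas fprod]) (simp only: *)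
  have "(LINT x|lborel. (\<Prod>j\<in>UNIV. f j ((x :: real ^ 'm) $ j))) =
      (LINT h|(\<Pi>\<^sub>M b\<in>Basis. lborel). (\<Prod>b\<in>Basis. g b (h b)))"
    by (subst lborel_eq, subst integral_distr[OF meas fprod]) (simp only: *)
  also have "\<dots> = (\<Prod>b\<in>Basis. integral\<^sup>L lborel (g b))"
    by (rule product_integral_prod) (auto intro: gi)
  also have "\<dots> = (\<Prod>j\<in>UNIV. integral\<^sup>L lborel (f j))"
    by (subst prod.reindex_bij_betw[OF bij_betw_axis_Basis, symmetric]) (simp add: g)
  finally show "(LINT x|lborel. (\<Prod>j\<in>UNIV. f j ((x :: real ^ 'm) $ j))) = (\<Prod>j\<in>UNIV. LINT w|lborel. f j w)" .
qed

text \<open>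
  The next three lemmas compute how a matrix scales Lebesgue measure, for an index type without an
  order. Every matrix is a product of diagonal matrices, transpositions and elementary shears, so
  only these have to be examined.
\<close>

lemma measure_lebesgue_swap_cbox:
  fixes m n :: "'m :: finite" and a b :: "real ^ 'm"
  defines "h \<equiv> \<lambda>x :: real ^ 'm. \<chi> i. x $ Transposition.transpose m n i"
  shows "measure lebesgue (h ` cbox a b) = measure lebesgue (cbox a b)"
proof -
  have hh: "h (h x) = x" for x by (simp add: h_def vec_eq_iff)
  have h_box: "h x \<in> cbox (h a) (h b) \<longleftrightarrow> x \<in> cbox a b" for x a b
    unfolding h_def mem_box_cart vec_lambda_beta by (metis transpose_involutory)
  have img: "h ` cbox a b = cbox (h a) (h b)"
  proof (intro equalityI subsetI)
    fix y assume "y \<in> cbox (h a) (h b)"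
    then show "y \<in> h ` cbox a b"
      using h_box[of "h y" a b] hh[of y] by (intro image_eqI[of _ _ "h y"]) auto
  qed (use h_box in auto)
  show ?thesis
  proof (cases "cbox a b = {}")
    case False
    then have "measure lebesgue (h ` cbox a b) = (\<Prod>i\<in>UNIV. (b - a) $ Transposition.transpose m n i)"
    proof -
      have "cbox (h a) (h b) \<noteq> {}" using False img by blast
      then show ?thesis unfolding img by (simp add: content_cbox_cart h_def)
    qed
    also have "\<dots> = (\<Prod>i\<in>UNIV. (b - a) $ i)"
      by (rule prod.reindex_bij_betw) simp
    finally show ?thesis using False by (simp add: content_cbox_cart)
  qed simp
qed

lemma measure_lebesgue_shear_cbox:
  fixes m n :: "'m :: finite" and a b :: "real ^ 'm"
  assumes "m \<noteq> n"
  defines "h \<equiv> \<lambda>x :: real ^ 'm. \<chi> i. if i = m then x $ m + x $ n else x $ i"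
  shows "measure lebesgue (h ` cbox a b) = measure lebesgue (cbox a b)"
proof (cases "cbox a b = {}")
  case False
  have add: "h (x + y) = h x + h y" for x y by (simp add: h_def vec_eq_iff)
  \<comment> \<open>A box with its lower corner at the origin meets the sign condition of \<open>measure_shear_interval\<close>.\<close>
  have shift: "cbox a b = (+) a ` cbox 0 (b - a)"
    by (simp add: cbox_translation[symmetric])
  then have ne: "cbox 0 (b - a) \<noteq> {}" using False by auto
  have "h ` cbox a b = (+) (h a) ` h ` cbox 0 (b - a)"
    unfolding shift image_image by (simp add: add)
  then have "measure lebesgue (h ` cbox a b) = measure lebesgue (h ` cbox 0 (b - a))"
    by (simp only: measure_translation)
  also have "\<dots> = measure lebesgue (cbox 0 (b - a))"
    unfolding h_def by (rule measure_shear_interval) (use assms(1) ne in auto)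
  also have "\<dots> = measure lebesgue (cbox a b)"
    unfolding shift by (simp only: measure_translation)
  finally show ?thesis .
qed simp

lemma
  fixes A :: "real ^ 'm ^ 'm"
  assumes A: "det A \<noteq> 0" and T: "T \<in> lmeasurable"
  shows measure_lebesgue_matrix_image: "(*v) A ` T \<in> lmeasurable"
    "measure lebesgue ((*v) A ` T) = \<bar>det A\<bar> * measure lebesgue T"
proof -
  let ?P = "\<lambda>A. det A \<noteq> 0 \<longrightarrow> (\<forall>T \<in> lmeasurable. (*v) A ` T \<in> lmeasurable \<and>
     measure lebesgue ((*v) A ` T) = \<bar>det A\<bar> * measure lebesgue T)"
  have cbox: "?P C" if "\<bar>det C\<bar> = 1" "\<And>a b. measure lebesgue ((*v) C ` cbox a b) = measure lebesgue (cbox a b)"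
    for C :: "real ^ 'm ^ 'm"
  proof (intro impI ballI)
    fix T :: "(real ^ 'm) set" assume "T \<in> lmeasurable"
    from measure_linear_sufficient[OF matrix_vector_mul_linear this, of C 1]
    show "(*v) C ` T \<in> lmeasurable \<and> measure lebesgue ((*v) C ` T) = \<bar>det C\<bar> * measure lebesgue T"
      unfolding that by (metis mult_1)
  qed
  have "?P A"
  proof (induction A rule: induct_matrix_elementary_alt)
    case (1 A B)
    have img: "(*v) (A ** B) ` T = (*v) A ` ((*v) B ` T)" for T
      by (simp add: image_image matrix_vector_mul_assoc)
    show ?case
      unfolding img det_mul abs_mult using 1 by auto
  next
    case (2 A i)
    then show ?case using det_zero_row by blast
  next
    case (3 A)
    then have "(A *v x) $ i = A $ i $ i * x $ i" for x i
      by (simp add: matrix_vector_mult_def sum.remove[of UNIV i])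
    then have "(*v) A = (\<lambda>x. \<chi> i. A $ i $ i * x $ i)"
      by (simp add: fun_eq_iff vec_eq_iff)
    then show ?case
      using 3 by (simp add: measurable_stretch measure_stretch det_diagonal)
  next
    case (4 m n)
    let ?A = "\<chi> i j. mat 1 $ i $ Transposition.transpose m n j :: real ^ 'm ^ 'm"
    have "(?A *v x) $ i = x $ Transposition.transpose m n i" for x i
    proof -
      have "i = Transposition.transpose m n j \<longleftrightarrow> j = Transposition.transpose m n i" for j
        by (metis transpose_involutory)
      then show ?thesis
        by (simp add: matrix_vector_mult_def mat_def if_distrib[of "\<lambda>c. c * _"] cong: if_cong)
    qed
    then have "(*v) ?A = (\<lambda>x. \<chi> i. x $ Transposition.transpose m n i)"
      by (simp add: fun_eq_iff vec_eq_iff)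
    then show ?case
      by (intro cbox) (simp_all only: measure_lebesgue_swap_cbox,
          simp add: det_permute_columns permutes_swap_id sign_swap_id abs_mult)
  next
    case (5 m n)
    let ?A = "\<chi> i j. of_bool (i = m \<and> j = n \<or> i = j) :: real ^ 'm ^ 'm"
    have "?A = (\<chi> k. if k = m then row m (mat 1) + 1 *s row n (mat 1) else row k (mat 1))"
      using 5 by (auto simp: vec_eq_iff row_def mat_def)
    then have "det ?A = 1"
      using det_row_operation[OF 5, of "mat 1" 1] by (simp only: det_I)
    moreover have "(?A *v x) $ i = (if i = m then x $ m + x $ n else x $ i)" for x i
    proof -
      have "(\<Sum>j\<in>UNIV. of_bool (i = m \<and> j = n \<or> i = j) * x $ j)
          = (\<Sum>j\<in>UNIV. (if j = i then x $ j else 0) + (if j = n then if i = m then x $ j else 0 else 0))"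
        using 5 by (intro sum.cong) auto
      then show ?thesis
        by (simp add: matrix_vector_mult_def sum.distrib)
    qed
    then have "(*v) ?A = (\<lambda>x. \<chi> i. if i = m then x $ m + x $ n else x $ i)"
      by (simp add: fun_eq_iff vec_eq_iff)
    ultimately show ?case
      by (intro cbox) (simp_all only: measure_lebesgue_shear_cbox[OF 5] abs_one)
  qed
  then show "(*v) A ` T \<in> lmeasurable" "measure lebesgue ((*v) A ` T) = \<bar>det A\<bar> * measure lebesgue T"
    using A T by auto
qed

lemma lborel_eq_density_distr_matrix:
  fixes S :: "real ^ 'm ^ 'm"
  assumes S: "invertible S"
  shows "lborel = density (distr lborel borel ((*v) S)) (\<lambda>_. ennreal \<bar>det S\<bar>)"
proof (rule lborel_eqI)
  let ?R = "matrix_inv S"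
  have dets: "det S * det ?R = 1"
    by (metis det_I det_mul matrix_inv_mult(1)[OF S])
  fix l u :: "real ^ 'm"
  assume "\<And>b. b \<in> Basis \<Longrightarrow> l \<bullet> b \<le> u \<bullet> b"
  then have lu: "emeasure lborel (box l u) = (\<Prod>b\<in>Basis. (u - l) \<bullet> b)"
    by (simp add: emeasure_lborel_box)
  have vimage: "(*v) S -` box l u = (*v) ?R ` box l u"
  proof safe
    fix x assume "S *v x \<in> box l u"
    then show "x \<in> (*v) ?R ` box l u"
      by (rule rev_image_eqI) (simp add: matrix_inv_mult_vec[OF S])
  qed (simp add: matrix_inv_mult_vec[OF S])
  have m: "(*v) S \<in> borel_measurable borel"
    by (intro borel_measurable_continuous_onI matrix_vector_mult_linear_continuous_on)
  have "emeasure (density (distr lborel borel ((*v) S)) (\<lambda>_. ennreal \<bar>det S\<bar>)) (box l u)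
      = ennreal \<bar>det S\<bar> * emeasure lborel ((*v) S -` box l u)"
    using m by (simp add: emeasure_density_const emeasure_distr)
  also have "emeasure lborel ((*v) S -` box l u) = emeasure lebesgue ((*v) ?R ` box l u)"
    unfolding vimage[symmetric] using measurable_sets_borel[OF m, of "box l u"] by simp
  also have "\<dots> = ennreal (measure lebesgue ((*v) ?R ` box l u))"
    using dets by (intro emeasure_eq_measure2 measure_lebesgue_matrix_image(1)) auto
  also have "measure lebesgue ((*v) ?R ` box l u) = \<bar>det ?R\<bar> * measure lebesgue (box l u)"
    using dets by (intro measure_lebesgue_matrix_image(2)) auto
  also have "ennreal \<bar>det S\<bar> * ennreal (\<bar>det ?R\<bar> * measure lebesgue (box l u)) = ennreal (measure lebesgue (box l u))"
    using dets by (simp add: ennreal_mult'[symmetric] mult.assoc[symmetric] abs_mult[symmetric])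
  also have "\<dots> = emeasure lborel (box l u)"
    using emeasure_bounded_finite[of "box l u"] by (simp add: emeasure_eq_ennreal_measure top.not_eq_extremum)
  finally show "emeasure (density (distr lborel borel ((*v) S)) (\<lambda>_. ennreal \<bar>det S\<bar>)) (box l u)
      = (\<Prod>b\<in>Basis. (u - l) \<bullet> b)"
    using lu by simp
qed simp

lemma borel_measurable_matrix_vector_mult [measurable]:
  "(*v) (S :: real ^ 'm ^ 'm) \<in> borel_measurable borel"
  by (intro borel_measurable_continuous_onI matrix_vector_mult_linear_continuous_on)

lemma integrable_scaleR_iff:
  fixes f :: "_ \<Rightarrow> 'a :: {banach, second_countable_topology}"
  assumes "c \<noteq> 0"
  shows "integrable N (\<lambda>x. c *\<^sub>R f x) \<longleftrightarrow> integrable N f"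
proof
  assume "integrable N (\<lambda>x. c *\<^sub>R f x)"
  then have "integrable N (\<lambda>x. inverse c *\<^sub>R c *\<^sub>R f x)" by (rule integrable_scaleR_right)
  moreover have "(\<lambda>x. inverse c *\<^sub>R c *\<^sub>R f x) = f" using assms by (simp add: fun_eq_iff)
  ultimately show "integrable N f" by (simp only:)
qed auto

lemma
  fixes S :: "real ^ 'm ^ 'm" and f :: "real ^ 'm \<Rightarrow> 'a :: {banach, second_countable_topology}"
  assumes S: "invertible S" and f [measurable]: "f \<in> borel_measurable borel"
  shows integrable_lborel_matrix: "integrable lborel (\<lambda>x. f (S *v x)) \<longleftrightarrow> integrable lborel f"
    and integral_lborel_matrix: "(LINT x|lborel. f x) = \<bar>det S\<bar> *\<^sub>R (LINT x|lborel. f (S *v x))"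
proof -
  have d: "det S \<noteq> 0" using S invertible_det_nz by blast
  show "integrable lborel (\<lambda>x. f (S *v x)) \<longleftrightarrow> integrable lborel f"
    using d by (subst (2) lborel_eq_density_distr_matrix[OF S])
      (simp add: integrable_density integrable_distr_eq integrable_scaleR_iff)
  show "(LINT x|lborel. f x) = \<bar>det S\<bar> *\<^sub>R (LINT x|lborel. f (S *v x))"
    using d by (subst lborel_eq_density_distr_matrix[OF S])
      (simp add: integral_density integral_distr)
qed

section \<open>Fourier transform of a complex Gaussian in several variables\<close>

definition gauss_cart :: "real ^ 'm ^ 'm \<Rightarrow> real ^ 'm \<Rightarrow> complex \<Rightarrow> real ^ 'm \<Rightarrow> complex" where
  "gauss_cart M b \<kappa> v = exp (- \<kappa> / 4 * of_real ((M *v v) \<bullet> v) + \<i> * of_real (b \<bullet> v))"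

lemma borel_measurable_gauss_cart [measurable]: "gauss_cart M b \<kappa> \<in> borel_measurable borel"
  unfolding gauss_cart_def[abs_def] by measurable

text \<open>
  In the variable \<open>w = S\<^sup>-\<^sup>1v\<close> with \<open>S\<^sup>\<star>MS = 1\<close> the integrand is a product of one-dimensional Gaussians
  with frequencies \<open>c = S\<^sup>\<star>b\<close>. The two constants come from \<open>SS\<^sup>\<star> = M\<^sup>-\<^sup>1\<close>, which gives
  \<open>|c|\<^sup>2 = \<langle>M\<^sup>-\<^sup>1b,b\<rangle>\<close>, and from \<open>(det S)\<^sup>2 det M = 1\<close>.
\<close>

lemma
  fixes M :: "real ^ 'm ^ 'm" and \<kappa> :: complex
  assumes M: "pos_def M" "transpose M = M" and \<kappa>: "Re \<kappa> > 0"
  shows integrable_gauss_cart: "integrable lborel (gauss_cart M b \<kappa>)"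
    and integral_gauss_cart: "(LINT v|lborel. gauss_cart M b \<kappa> v)
      = csqrt (of_real (4 * pi) / \<kappa>) ^ CARD('m) / of_real (sqrt (det M))
        * exp (- of_real ((matrix_inv M *v b) \<bullet> b) / \<kappa>)"
proof -
  obtain S :: "real ^ 'm ^ 'm" where S: "transpose S ** M ** S = mat 1"
    using pos_def_congruent_to_identity[OF M] .
  have dets: "(det S)\<^sup>2 * det M = 1"
    using arg_cong[OF S, of det] by (simp add: det_mul power2_eq_square mult_ac)
  have pos: "det M > 0"
    by (rule det_pos_def[OF M])
  have "\<bar>det S\<bar> * sqrt (det M) = 1"
    using arg_cong[OF dets, of sqrt] by (simp add: real_sqrt_mult)
  then have detS: "\<bar>det S\<bar> = 1 / sqrt (det M)"
    using pos by (simp add: field_simps)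
  have inv: "invertible S" using S invertible_left_inverse by blast
  have "S ** (transpose S ** M) = mat 1"
    using S matrix_left_right_inverse by blast
  then have "M ** (S ** transpose S) = mat 1"
    using matrix_left_right_inverse by (metis matrix_mul_assoc)
  then have Minv: "matrix_inv M = S ** transpose S"
    by (rule matrix_inv_unique_real)
  define c where "c = transpose S *v b"
  have MS: "(M *v (S *v w)) \<bullet> (S *v w) = w \<bullet> w" for w
  proof -
    have "(M *v (S *v w)) \<bullet> (S *v w) = ((transpose S ** M ** S) *v w) \<bullet> w"
      by (metis inner_mult_vec_transpose matrix_vector_mul_assoc transpose_transpose)
    then show ?thesis by (simp add: S)
  qed
  have bS: "b \<bullet> (S *v w) = c \<bullet> w" for w
    unfolding c_def by (metis inner_commute inner_mult_vec_transpose)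
  have cc: "(\<Sum>j\<in>UNIV. (c $ j)\<^sup>2) = (matrix_inv M *v b) \<bullet> b"
  proof -
    have "(\<Sum>j\<in>UNIV. (c $ j)\<^sup>2) = c \<bullet> c" by (simp add: inner_vec_def power2_eq_square)
    also have "\<dots> = (S *v c) \<bullet> b" using bS[of c] by (simp add: inner_commute)
    finally show ?thesis by (simp add: Minv c_def matrix_vector_mul_assoc[symmetric] del: transpose_matrix_vector)
  qed
  have prod: "gauss_cart M b \<kappa> (S *v w) = (\<Prod>j\<in>UNIV. gauss (c $ j) \<kappa> (w $ j))" for w
    unfolding gauss_cart_def gauss_def exp_sum[symmetric, OF finite] MS bS
    by (simp add: inner_vec_def sum.distrib sum_subtractf sum_negf sum_distrib_left power2_eq_square)
  have "integrable lborel (\<lambda>w. gauss_cart M b \<kappa> (S *v w))"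
    unfolding prod by (intro integrable_lborel_cart_prod integrable_gauss \<kappa>)
  then show "integrable lborel (gauss_cart M b \<kappa>)"
    by (subst (asm) integrable_lborel_matrix[OF inv]) auto
  have "(LINT v|lborel. gauss_cart M b \<kappa> v) = \<bar>det S\<bar> *\<^sub>R (LINT w|lborel. gauss_cart M b \<kappa> (S *v w))"
    by (rule integral_lborel_matrix[OF inv]) auto
  also have "(LINT w|lborel. gauss_cart M b \<kappa> (S *v w)) = (\<Prod>j\<in>UNIV. LINT w|lborel. gauss (c $ j) \<kappa> w)"
    unfolding prod by (intro integral_lborel_cart_prod integrable_gauss \<kappa>)
  also have "\<dots> = csqrt (of_real (4 * pi) / \<kappa>) ^ CARD('m) * exp (\<Sum>j\<in>UNIV. - (of_real (c $ j))\<^sup>2 / \<kappa>)"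
    by (simp add: gauss_integral[OF \<kappa>] prod.distrib exp_sum)
  also have "(\<Sum>j\<in>UNIV. - (of_real (c $ j))\<^sup>2 / \<kappa>) = - of_real (\<Sum>j\<in>UNIV. (c $ j)\<^sup>2) / \<kappa>"
    by (simp add: sum_negf sum_divide_distrib)
  finally show "(LINT v|lborel. gauss_cart M b \<kappa> v)
      = csqrt (of_real (4 * pi) / \<kappa>) ^ CARD('m) / of_real (sqrt (det M))
        * exp (- of_real ((matrix_inv M *v b) \<bullet> b) / \<kappa>)"
    by (simp add: cc detS scaleR_conv_of_real)
qed

section \<open>Rapidly decreasing functions\<close>

lemma has_vector_derivative_along_axis:
  fixes f :: "real ^ 'm \<Rightarrow> complex"
  assumes "(f has_derivative f') (at (x + t *\<^sub>R axis j 1))"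
  shows "((\<lambda>h. f (x + h *\<^sub>R axis j 1)) has_vector_derivative f' (axis j 1)) (at t within S)"
proof -
  have l: "((\<lambda>h. x + h *\<^sub>R axis j 1) has_derivative (\<lambda>h. h *\<^sub>R axis j 1)) (at t within S)"
    by (auto intro!: derivative_eq_intros)
  have "((\<lambda>h. f (x + h *\<^sub>R axis j 1)) has_derivative (\<lambda>h. f' (h *\<^sub>R axis j 1))) (at t within S)"
    using has_derivative_compose[OF l assms] .
  moreover have "f' (h *\<^sub>R axis j 1) = h *\<^sub>R f' (axis j 1)" for h
    using assms has_derivative_linear linear_scale by blast
  ultimately show ?thesis by (simp add: has_vector_derivative_def)
qed

lemma partial_deriv_eq:
  fixes f :: "real ^ 'm \<Rightarrow> complex"
  assumes "(f has_derivative f') (at x)"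
  shows "partial_deriv j f x = f' (axis j 1)"
  unfolding partial_deriv_def
  by (rule vector_derivative_at, rule has_vector_derivative_along_axis) (use assms in simp)

text \<open>
  The span of the functions \<open>x\<^sup>\<alpha> \<partial>\<^sup>\<beta>\<phi>\<close>. It contains all functions that repeated integration by parts can
  produce from \<open>\<phi>\<close>. Being generated by \<open>\<phi>\<close>, it has the closure properties of the Schwartz space that
  are needed by simple inductions, without any product rule for iterated derivatives.
\<close>

inductive_set weighted_derivs :: "(real ^ 'm \<Rightarrow> complex) \<Rightarrow> (real ^ 'm \<Rightarrow> complex) set"
  for \<phi> :: "real ^ 'm \<Rightarrow> complex" where
  deriv: "iter_partial js \<phi> \<in> weighted_derivs \<phi>"
| coord: "f \<in> weighted_derivs \<phi> \<Longrightarrow> (\<lambda>y. of_real (y $ k) * f y) \<in> weighted_derivs \<phi>"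
| scale: "f \<in> weighted_derivs \<phi> \<Longrightarrow> (\<lambda>y. c * f y) \<in> weighted_derivs \<phi>"
| add: "f \<in> weighted_derivs \<phi> \<Longrightarrow> g \<in> weighted_derivs \<phi> \<Longrightarrow> (\<lambda>y. f y + g y) \<in> weighted_derivs \<phi>"

lemma weighted_derivs_self: "\<phi> \<in> weighted_derivs \<phi>"
  using weighted_derivs.deriv[of "[]" \<phi>] by (simp add: iter_partial_def)

lemma weighted_derivs_sum:
  assumes "finite K" "\<And>k. k \<in> K \<Longrightarrow> f k \<in> weighted_derivs \<phi>"
  shows "(\<lambda>y. \<Sum>k\<in>K. f k y) \<in> weighted_derivs \<phi>"
  using assms
proof (induction K rule: finite_induct)
  case empty
  show ?case using weighted_derivs.scale[OF weighted_derivs_self, of 0] by simp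
next
  case (insert k K)
  then show ?case by (simp add: weighted_derivs.add)
qed

lemma weighted_derivs_weight:
  fixes \<phi> :: "real ^ 'm \<Rightarrow> complex"
  assumes "f \<in> weighted_derivs \<phi>"
  shows "(\<lambda>y. of_real (\<Prod>k\<in>K. 1 + (y $ k)\<^sup>2) * f y) \<in> weighted_derivs \<phi>"
proof -
  have "finite K" by simp
  then show ?thesis
  proof (induction K rule: finite_induct)
    case (insert k K)
    let ?g = "\<lambda>y. of_real (\<Prod>k\<in>K. 1 + (y $ k)\<^sup>2) * f y"
    have "(\<lambda>y. ?g y + of_real (y $ k) * (of_real (y $ k) * ?g y)) \<in> weighted_derivs \<phi>"
      by (intro weighted_derivs.add weighted_derivs.coord insert.IH)
    also have "(\<lambda>y. ?g y + of_real (y $ k) * (of_real (y $ k) * ?g y))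
        = (\<lambda>y. of_real (\<Prod>k\<in>insert k K. 1 + (y $ k)\<^sup>2) * f y)"
      using insert.hyps by (simp add: fun_eq_iff algebra_simps power2_eq_square)
    finally show ?case .
  qed (simp add: assms)
qed

lemma weighted_derivs_differentiable:
  fixes \<phi> :: "real ^ 'm \<Rightarrow> complex"
  assumes "\<phi> \<in> schwartz" "f \<in> weighted_derivs \<phi>"
  shows "f differentiable (at x)"
  using assms(2)
proof induction
  case (deriv js)
  then show ?case
    using assms(1) by (auto simp: schwartz_def smooth_def differentiable_on_def)
next
  case (coord f k)
  have "(\<lambda>y :: real ^ 'm. complex_of_real (y $ k)) differentiable (at x)"
    by (intro bounded_linear_imp_differentiable bounded_linear_compose[OF bounded_linear_of_real]
        bounded_linear_vec_nth)
  with coord show ?case by (intro differentiable_mult)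
qed (auto intro!: differentiable_mult)

lemma weighted_derivs_partial:
  fixes \<phi> :: "real ^ 'm \<Rightarrow> complex"
  assumes \<phi>: "\<phi> \<in> schwartz" and "f \<in> weighted_derivs \<phi>"
  shows "partial_deriv j f \<in> weighted_derivs \<phi>"
  using assms(2)
proof induction
  case (deriv js)
  then show ?case
    using weighted_derivs.deriv[of "j # js" \<phi>] by (simp add: iter_partial_def)
next
  case (coord f k)
  have "partial_deriv j (\<lambda>y. of_real (y $ k) * f y) x
      = of_real (x $ k) * partial_deriv j f x + (if j = k then 1 else 0) * f x" for x
  proof -
    obtain f' where f': "(f has_derivative f') (at x)"
      using weighted_derivs_differentiable[OF \<phi> coord.hyps] differentiable_def by blast
    have "((\<lambda>y. complex_of_real (y $ k)) has_derivative (\<lambda>h. of_real (h $ k))) (at x)"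
      by (intro bounded_linear_imp_has_derivative bounded_linear_compose[OF bounded_linear_of_real]
          bounded_linear_vec_nth)
    from partial_deriv_eq[OF has_derivative_mult[OF this f'], of j] partial_deriv_eq[OF f', of j]
    show ?thesis by (auto simp: axis_def)
  qed
  then have "partial_deriv j (\<lambda>y. of_real (y $ k) * f y)
      = (\<lambda>x. of_real (x $ k) * partial_deriv j f x + (if j = k then 1 else 0) * f x)" by blast
  then show ?case
    using coord by (auto intro!: weighted_derivs.add weighted_derivs.coord weighted_derivs.scale simp del: mult_zero_left mult_1_left)
next
  case (scale f c)
  have "partial_deriv j (\<lambda>y. c * f y) x = c * partial_deriv j f x" for x
  proof -
    obtain f' where f': "(f has_derivative f') (at x)"
      using weighted_derivs_differentiable[OF \<phi> scale.hyps] differentiable_def by blast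
    then show ?thesis
      using partial_deriv_eq[OF has_derivative_mult_right[OF f']] partial_deriv_eq[OF f'] by auto
  qed
  then have "partial_deriv j (\<lambda>y. c * f y) = (\<lambda>x. c * partial_deriv j f x)" by blast
  then show ?case using scale by (auto intro: weighted_derivs.scale)
next
  case (add f g)
  have "partial_deriv j (\<lambda>y. f y + g y) x = partial_deriv j f x + partial_deriv j g x" for x
  proof -
    obtain f' g' where f': "(f has_derivative f') (at x)" and g': "(g has_derivative g') (at x)"
      using weighted_derivs_differentiable[OF \<phi>] add.hyps differentiable_def by blast
    then show ?thesis
      using partial_deriv_eq[OF has_derivative_add[OF f' g']] partial_deriv_eq[OF f'] partial_deriv_eq[OF g'] by auto
  qed
  then have "partial_deriv j (\<lambda>y. f y + g y) = (\<lambda>x. partial_deriv j f x + partial_deriv j g x)" by blast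
  then show ?case using add by (auto intro: weighted_derivs.add)
qed

text \<open>
  The arbitrary weight \<open>\<alpha>\<close> makes the induction work: a factor \<open>x\<^sub>k\<close> of the function is absorbed by
  raising \<open>\<alpha>\<^sub>k\<close>.
\<close>

lemma weighted_derivs_bounded:
  fixes \<phi> :: "real ^ 'm \<Rightarrow> complex"
  assumes \<phi>: "\<phi> \<in> schwartz" and "f \<in> weighted_derivs \<phi>"
  shows "bounded (range (\<lambda>x. complex_of_real (\<Prod>j\<in>UNIV. (x $ j) ^ \<alpha> j) * f x))"
  using assms(2)
proof (induction arbitrary: \<alpha>)
  case (deriv js)
  then show ?case using \<phi> by (auto simp: schwartz_def)
next
  case (coord f k)
  have "(\<Prod>j\<in>UNIV. (x $ j) ^ (\<alpha>(k := Suc (\<alpha> k))) j) = (\<Prod>j\<in>UNIV. (x $ j) ^ \<alpha> j) * x $ k" for x :: "real ^ 'm"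
    by (simp add: prod.remove[of UNIV k])
  then show ?case using coord.IH[of "\<alpha>(k := Suc (\<alpha> k))"] by (simp add: mult.assoc)
next
  case (scale f c)
  then obtain C where C: "\<And>x. norm (complex_of_real (\<Prod>j\<in>UNIV. (x $ j) ^ \<alpha> j) * f x) \<le> C"
    unfolding bounded_iff by blast
  have "norm (complex_of_real (\<Prod>j\<in>UNIV. (x $ j) ^ \<alpha> j) * (c * f x)) \<le> norm c * C" for x
    using mult_left_mono[OF C[of x], of "norm c"] by (simp add: norm_mult mult_ac)
  then show ?case unfolding bounded_iff by blast
next
  case (add f g)
  from bounded_plus_comp[OF add.IH] show ?case by (simp add: algebra_simps)
qed

text \<open>
  An integrable majorant of product form. Unlike a power of \<open>1 + |y|\<^sup>2\<close> it is obtained by treating one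
  coordinate at a time.
\<close>

definition cauchy_weight :: "real ^ 'm \<Rightarrow> real" where
  "cauchy_weight y = (\<Prod>k\<in>UNIV. inverse (1 + (y $ k)\<^sup>2))"

lemma cauchy_weight_pos: "cauchy_weight y > 0"
  unfolding cauchy_weight_def by (intro prod_pos) (simp add: add_pos_nonneg)

lemma integrable_cauchy_weight: "integrable lborel cauchy_weight"
  unfolding cauchy_weight_def[abs_def]
  by (intro integrable_lborel_cart_prod)
    (use integrable_inverse_1_plus_square in \<open>simp add: set_integrable_def\<close>)

lemma borel_measurable_cauchy_weight [measurable]: "cauchy_weight \<in> borel_measurable borel"
  using borel_measurable_integrable[OF integrable_cauchy_weight] by simp

lemma weighted_derivs_decay:
  assumes "\<phi> \<in> schwartz" "f \<in> weighted_derivs \<phi>"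
  shows "\<exists>C. \<forall>y. norm (f y) \<le> C * cauchy_weight y"
proof -
  obtain C where C: "\<And>y. norm (of_real (\<Prod>k\<in>UNIV. 1 + (y $ k)\<^sup>2) * f y) \<le> C"
    using weighted_derivs_bounded[OF assms(1) weighted_derivs_weight[OF assms(2), of UNIV], of "\<lambda>_. 0"]
    by (auto simp: bounded_iff)
  have "norm (f y) \<le> C * cauchy_weight y" for y
  proof -
    let ?P = "\<Prod>k\<in>UNIV. 1 + (y $ k)\<^sup>2"
    have P: "?P > 0" by (intro prod_pos) (simp add: add_pos_nonneg)
    have "?P * norm (f y) \<le> C"
      using C[of y] P by (simp add: norm_mult del: of_real_prod)
    then have "norm (f y) \<le> C / ?P"
      using P by (simp add: field_simps)
    then show ?thesis
      by (simp add: cauchy_weight_def prod_inversef[symmetric] o_def divide_inverse)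
  qed
  then show ?thesis by blast
qed

lemma weighted_derivs_measurable:
  assumes "\<phi> \<in> schwartz" "f \<in> weighted_derivs \<phi>"
  shows "f \<in> borel_measurable borel"
  using weighted_derivs_differentiable[OF assms]
  by (intro borel_measurable_continuous_onI)
    (simp add: continuous_at_imp_continuous_on differentiable_imp_continuous_within)

lemma integrable_of_cauchy_weight_bound:
  fixes f :: "real ^ 'm \<Rightarrow> complex"
  assumes "f \<in> borel_measurable borel" "\<And>y. norm (f y) \<le> C * cauchy_weight y"
  shows "integrable lborel f"
proof (rule Bochner_Integration.integrable_bound[OF integrable_mult_right[OF integrable_cauchy_weight, of C]])
  show "AE y in lborel. norm (f y) \<le> norm (C * cauchy_weight y)"
    using order_trans[OF assms(2) abs_ge_self] by simp
qed (use assms(1) in simp)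

lemma weighted_derivs_integrable:
  assumes "\<phi> \<in> schwartz" "f \<in> weighted_derivs \<phi>"
  shows "integrable lborel f"
  using weighted_derivs_decay[OF assms] integrable_of_cauchy_weight_bound[OF weighted_derivs_measurable[OF assms]]
  by blast

text \<open>
  Only the factor of index \<open>j\<close> changes, and \<open>1 + a\<^sup>2 \<le> 3 (1 + (a + t)\<^sup>2)\<close> for \<open>|t| \<le> 1\<close>. So one function
  dominates a family of nearby translates, as dominated convergence requires.
\<close>

lemma cauchy_weight_shift:
  assumes "\<bar>t\<bar> \<le> 1"
  shows "cauchy_weight (y + t *\<^sub>R axis j 1) \<le> 3 * cauchy_weight y"
proof -
  let ?r = "\<Prod>k\<in>UNIV - {j}. inverse (1 + (y $ k)\<^sup>2)"
  have r: "?r \<ge> 0" by (intro prod_nonneg) simp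
  have "t\<^sup>2 \<le> 1" using assms by (simp add: abs_square_le_1)
  then have "1 + (y $ j)\<^sup>2 \<le> 3 * (1 + (y $ j + t)\<^sup>2)"
    using zero_le_power2[of "2 * (y $ j) + 3 * t"] by (simp add: power2_eq_square algebra_simps)
  then have "inverse (1 + (y $ j + t)\<^sup>2) \<le> 3 * inverse (1 + (y $ j)\<^sup>2)"
    by (simp add: divide_simps add_pos_nonneg add_nonneg_eq_0_iff)
  then have "inverse (1 + (y $ j + t)\<^sup>2) * ?r \<le> 3 * inverse (1 + (y $ j)\<^sup>2) * ?r"
    using r by (rule mult_right_mono)
  moreover have "(\<Prod>k\<in>UNIV - {j}. inverse (1 + ((y + t *\<^sub>R axis j 1) $ k)\<^sup>2)) = ?r"
    by (intro prod.cong) (auto simp: axis_def)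
  ultimately show ?thesis
    by (simp add: cauchy_weight_def prod.remove[of UNIV j] mult.assoc axis_def)
qed

lemma
  fixes f :: "'a :: euclidean_space \<Rightarrow> 'b :: {banach, second_countable_topology}"
  assumes f: "f \<in> borel_measurable borel"
  shows integrable_lborel_shift: "integrable lborel (\<lambda>x. f (x + a)) \<longleftrightarrow> integrable lborel f"
    and integral_lborel_shift: "(LINT x|lborel. f (x + a)) = (LINT x|lborel. f x)"
proof -
  have d: "lborel = distr lborel borel (\<lambda>x. x + a)"
  proof -
    have "(\<lambda>x. x + a) = (+) a" by (simp add: fun_eq_iff add.commute)
    then show ?thesis by (simp only: lborel_distr_plus)
  qed
  show "integrable lborel (\<lambda>x. f (x + a)) \<longleftrightarrow> integrable lborel f"
    using f by (subst (2) d) (simp add: integrable_distr_eq)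
  show "(LINT x|lborel. f (x + a)) = (LINT x|lborel. f x)"
    using f by (subst (2) d) (simp add: integral_distr)
qed

text \<open>
  The difference quotients of \<open>g\<close> in direction \<open>j\<close> have integral zero, because Lebesgue measure is
  translation invariant. By the mean value inequality and \<open>cauchy_weight_shift\<close> they are dominated,
  so their limit has integral zero as well.
\<close>

lemma integral_partial_deriv_eq_0:
  fixes g :: "real ^ 'm \<Rightarrow> complex"
  assumes diff: "\<And>y. g differentiable (at y)"
    and g: "\<And>y. norm (g y) \<le> C * cauchy_weight y"
    and g': "\<And>y. norm (partial_deriv j g y) \<le> D * cauchy_weight y"
    and m: "partial_deriv j g \<in> borel_measurable borel"
  shows "(LINT y|lborel. partial_deriv j g y) = 0"
proof -
  define h where "h n = 1 / real (Suc n)" for n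
  have h: "0 < h n" "h n \<le> 1" for n by (auto simp: h_def)
  have D: "D \<ge> 0"
    using g'[of 0] cauchy_weight_pos[of "0 :: real ^ 'm"] by (smt (verit) mult_neg_pos norm_ge_zero)
  have gm: "g \<in> borel_measurable borel"
    using diff by (intro borel_measurable_continuous_onI)
      (simp add: continuous_at_imp_continuous_on differentiable_imp_continuous_within)
  have gi: "integrable lborel g"
    by (rule integrable_of_cauchy_weight_bound[OF gm g])
  have vd: "((\<lambda>s. g (y + s *\<^sub>R axis j 1)) has_vector_derivative partial_deriv j g (y + t *\<^sub>R axis j 1)) (at t within S)"
    for y t S
  proof -
    obtain f' where "(g has_derivative f') (at (y + t *\<^sub>R axis j 1))"
      using diff differentiable_def by blast
    then show ?thesis
      using has_vector_derivative_along_axis partial_deriv_eq by metis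
  qed
  let ?q = "\<lambda>n y. (1 / h n) *\<^sub>R (g (y + h n *\<^sub>R axis j 1) - g y)"
  have "(\<lambda>n. LINT y|lborel. ?q n y) \<longlonglongrightarrow> (LINT y|lborel. partial_deriv j g y)"
  proof (rule integral_dominated_convergence)
    show "integrable lborel (\<lambda>y :: real ^ 'm. 3 * D * cauchy_weight y)"
      by (intro integrable_mult_right integrable_cauchy_weight)
  next
    fix n
    show "AE y in lborel. norm (?q n y) \<le> 3 * D * cauchy_weight y"
    proof (rule AE_I2)
      fix y :: "real ^ 'm"
      have "norm (g (y + h n *\<^sub>R axis j 1) - g (y + 0 *\<^sub>R axis j 1))
          \<le> (3 * D * cauchy_weight y) * norm (h n - 0)"
      proof (rule differentiable_bound[where S = "{0..h n}" and f' = "\<lambda>t s. s *\<^sub>R partial_deriv j g (y + t *\<^sub>R axis j 1)"])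
        fix t assume t: "t \<in> {0..h n}"
        show "((\<lambda>s. g (y + s *\<^sub>R axis j 1)) has_derivative (\<lambda>s. s *\<^sub>R partial_deriv j g (y + t *\<^sub>R axis j 1))) (at t within {0..h n})"
          using vd[unfolded has_vector_derivative_def] .
        have "norm (partial_deriv j g (y + t *\<^sub>R axis j 1)) \<le> D * cauchy_weight (y + t *\<^sub>R axis j 1)"
          by (rule g')
        also have "\<dots> \<le> D * (3 * cauchy_weight y)"
          using t h(2)[of n] D by (intro mult_left_mono cauchy_weight_shift) auto
        finally show "onorm (\<lambda>s. s *\<^sub>R partial_deriv j g (y + t *\<^sub>R axis j 1)) \<le> 3 * D * cauchy_weight y"
          using D cauchy_weight_pos[of y]
          by (intro onorm_bound) (auto simp: mult.commute[of _ "norm _"] intro!: mult_right_mono)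
      qed (use h(1)[of n] in auto)
      then show "norm (?q n y) \<le> 3 * D * cauchy_weight y"
        unfolding norm_scaleR using h(1)[of n] by (simp add: field_simps)
    qed
  next
    show "AE y in lborel. (\<lambda>n. ?q n y) \<longlonglongrightarrow> partial_deriv j g y"
    proof (rule AE_I2)
      fix y :: "real ^ 'm"
      let ?D = "partial_deriv j g y"
      have "((\<lambda>s. norm (g (y + s *\<^sub>R axis j 1) - g y - s *\<^sub>R ?D) / norm s) \<longlongrightarrow> 0) (at 0)"
        using vd[of y 0 UNIV] unfolding has_vector_derivative_def has_derivative_iff_norm by simp
      moreover have "\<forall>\<^sub>F s in at 0. norm (g (y + s *\<^sub>R axis j 1) - g y - s *\<^sub>R ?D) / norm s
          = norm ((1 / s) *\<^sub>R (g (y + s *\<^sub>R axis j 1) - g y) - ?D)"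
        unfolding eventually_at_filter
      proof (intro always_eventually allI impI)
        fix s :: real assume s: "s \<noteq> 0"
        then have "(1 / s) *\<^sub>R (g (y + s *\<^sub>R axis j 1) - g y) - ?D
            = (1 / s) *\<^sub>R (g (y + s *\<^sub>R axis j 1) - g y - s *\<^sub>R ?D)"
          by (simp add: scaleR_diff_right)
        then show "norm (g (y + s *\<^sub>R axis j 1) - g y - s *\<^sub>R ?D) / norm s
          = norm ((1 / s) *\<^sub>R (g (y + s *\<^sub>R axis j 1) - g y) - ?D)"
          by simp
      qed
      ultimately have "((\<lambda>s. norm ((1 / s) *\<^sub>R (g (y + s *\<^sub>R axis j 1) - g y) - ?D)) \<longlongrightarrow> 0) (at 0)"
        by (rule Lim_transform_eventually)
      then have "((\<lambda>s. (1 / s) *\<^sub>R (g (y + s *\<^sub>R axis j 1) - g y)) \<longlongrightarrow> ?D) (at 0)"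
        by (simp only: tendsto_norm_zero_iff Lim_null[symmetric])
      moreover have "filterlim h (at 0) sequentially"
        using h(1) LIMSEQ_Suc[OF lim_1_over_n[where 'a = real]]
        by (auto simp: filterlim_at h_def[abs_def] simp del: of_nat_Suc)
      ultimately show "(\<lambda>n. ?q n y) \<longlonglongrightarrow> partial_deriv j g y"
        by (rule filterlim_compose)
    qed
  qed (use gm m in measurable)
  moreover have "(LINT y|lborel. ?q n y) = 0" for n
    using gi gm integrable_lborel_shift[OF gm, of "h n *\<^sub>R axis j 1"] integral_lborel_shift[OF gm, of "h n *\<^sub>R axis j 1"]
    by simp
  ultimately have "(\<lambda>n. 0) \<longlonglongrightarrow> (LINT y|lborel. partial_deriv j g y)"
    by (simp only:)
  then show ?thesis by (rule LIMSEQ_unique[OF _ tendsto_const])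
qed


section \<open>Oscillating Gaussians and decay of their convolutions\<close>

definition phase :: "real ^ 'm ^ 'm \<Rightarrow> real ^ 'm \<Rightarrow> complex" where
  "phase R w = exp (\<i> * complex_of_real ((R *v w) \<bullet> w) / 4)"

lemma norm_phase [simp]: "norm (phase R w) = 1"
  by (simp add: phase_def)

lemma borel_measurable_phase [measurable]: "phase R \<in> borel_measurable borel"
  unfolding phase_def[abs_def] by measurable

definition phase_transform :: "real ^ 'm ^ 'm \<Rightarrow> (real ^ 'm \<Rightarrow> complex) \<Rightarrow> real ^ 'm \<Rightarrow> complex" where
  "phase_transform R f v = (LINT y|lborel. phase R (y - v) * f y)"

lemma phase_transform_scale: "phase_transform R (\<lambda>y. c * f y) v = c * phase_transform R f v"
  by (simp add: phase_transform_def mult.left_commute[of "phase R _" c])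

lemma has_derivative_phase:
  fixes R :: "real ^ 'm ^ 'm"
  assumes "transpose R = R"
  shows "((\<lambda>y. phase R (y - v)) has_derivative
    (\<lambda>h. phase R (y - v) * (\<i> / 2 * of_real ((R *v (y - v)) \<bullet> h)))) (at y)"
proof -
  have lin: "((*v) R has_derivative (*v) R) F" for F
    by (intro bounded_linear_imp_has_derivative matrix_vector_mul_bounded_linear)
  have sub: "((\<lambda>y. y - v) has_derivative (\<lambda>h. h)) (at y)"
    by (auto intro!: derivative_eq_intros)
  have "((\<lambda>y. (R *v (y - v)) \<bullet> (y - v)) has_derivative
      (\<lambda>h. (R *v (y - v)) \<bullet> h + (R *v h) \<bullet> (y - v))) (at y)"
    by (rule has_derivative_inner[OF has_derivative_compose[OF sub lin] sub])
  also have "(\<lambda>h. (R *v (y - v)) \<bullet> h + (R *v h) \<bullet> (y - v)) = (\<lambda>h. 2 * ((R *v (y - v)) \<bullet> h))"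
    by (simp add: fun_eq_iff inner_mult_vec_symmetric[OF assms, of _ "y - v"])
  finally have *: "((\<lambda>y. (R *v (y - v)) \<bullet> (y - v)) has_derivative (\<lambda>h. 2 * ((R *v (y - v)) \<bullet> h))) (at y)" .
  have "((\<lambda>y. ((R *v (y - v)) \<bullet> (y - v)) *\<^sub>R (\<i> / 4)) has_derivative
      (\<lambda>h. (2 * ((R *v (y - v)) \<bullet> h)) *\<^sub>R (\<i> / 4))) (at y)"
    by (rule has_derivative_scaleR_left[OF *])
  from has_derivative_compose[OF this DERIV_exp[unfolded has_field_derivative_def]]
  show ?thesis
    by (simp add: phase_def scaleR_conv_of_real mult_ac)
qed

text \<open>
  Since \<open>\<partial>\<^sub>j\<close> acts on the phase as multiplication by \<open>(i/2) (R(y - v))\<^sub>j\<close>, the part of this factor that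
  depends on \<open>v\<close> can be traded for a derivative of \<open>f\<close> and a polynomial factor.
\<close>

lemma phase_transform_by_parts:
  fixes R :: "real ^ 'm ^ 'm"
  assumes \<phi>: "\<phi> \<in> schwartz" and R: "transpose R = R" and f: "f \<in> weighted_derivs \<phi>"
  obtains f\<^sub>2 where "f\<^sub>2 \<in> weighted_derivs \<phi>"
    "\<And>v. of_real ((R *v v) $ j / 2) * phase_transform R f v = phase_transform R f\<^sub>2 v"
proof -
  let ?D = "\<lambda>y. partial_deriv j f y + \<i> / 2 * (of_real ((R *v y) $ j) * f y)"
  have mult: "(\<lambda>y. of_real ((R *v y) $ j) * f y) \<in> weighted_derivs \<phi>"
  proof -
    have "(\<lambda>y. \<Sum>k\<in>UNIV. of_real (R $ j $ k) * (of_real (y $ k) * f y)) \<in> weighted_derivs \<phi>"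
      by (intro weighted_derivs_sum weighted_derivs.scale weighted_derivs.coord f) simp
    then show ?thesis
      by (simp add: matrix_vector_mult_def sum_distrib_right mult.assoc)
  qed
  have D: "?D \<in> weighted_derivs \<phi>"
    by (intro weighted_derivs.add weighted_derivs.scale weighted_derivs_partial[OF \<phi>] f mult)
  have int: "integrable lborel (\<lambda>y. phase R (y - v) * g y)" if "g \<in> weighted_derivs \<phi>" for g v
    using weighted_derivs_measurable[OF \<phi> that]
    by (intro Bochner_Integration.integrable_bound[OF weighted_derivs_integrable[OF \<phi> that]])
      (auto simp: norm_mult)
  have *: "\<i> * of_real ((R *v v) $ j / 2) * phase_transform R f v = phase_transform R ?D v" for v
  proof -
    \<comment> \<open>The derivative of the product is the phase times \<open>?d\<close>: the operator \<open>?D\<close> plus a multiple of \<open>f\<close> that depends on \<open>v\<close>.\<close>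
    define c where "c = - \<i> / 2 * of_real ((R *v v) $ j)"
    let ?g = "\<lambda>y. phase R (y - v) * f y"
    let ?d = "\<lambda>y. ?D y + (- \<i> / 2 * of_real ((R *v v) $ j)) * f y"
    have d: "?d \<in> weighted_derivs \<phi>"
      by (intro weighted_derivs.add[OF D] weighted_derivs.scale f)
    have diff: "(?g has_derivative (\<lambda>h. phase R (y - v) * f' h
        + phase R (y - v) * (\<i> / 2 * of_real ((R *v (y - v)) \<bullet> h)) * f y)) (at y)"
      if "(f has_derivative f') (at y)" for y f'
      by (rule has_derivative_mult[OF has_derivative_phase[OF R] that])
    have pd: "partial_deriv j ?g y = phase R (y - v) * ?d y" for y
    proof -
      obtain f' where f': "(f has_derivative f') (at y)"
        using weighted_derivs_differentiable[OF \<phi> f] differentiable_def by blast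
      show ?thesis
        unfolding partial_deriv_eq[OF diff[OF f']] partial_deriv_eq[OF f']
        by (simp add: inner_axis matrix_vector_mult_diff_distrib algebra_simps diff_divide_distrib)
    qed
    obtain C D' where C: "\<And>y. norm (f y) \<le> C * cauchy_weight y" "\<And>y. norm (?d y) \<le> D' * cauchy_weight y"
      using weighted_derivs_decay[OF \<phi> f] weighted_derivs_decay[OF \<phi> d] by blast
    have "(LINT y|lborel. partial_deriv j ?g y) = 0"
    proof (rule integral_partial_deriv_eq_0)
      show "?g differentiable (at y)" for y
        using diff weighted_derivs_differentiable[OF \<phi> f] unfolding differentiable_def by blast
      show "norm (?g y) \<le> C * cauchy_weight y" for y
        using C(1)[of y] by (simp add: norm_mult)
      show "norm (partial_deriv j ?g y) \<le> D' * cauchy_weight y" for y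
        unfolding pd norm_mult norm_phase using C(2)[of y] by simp
      show "partial_deriv j ?g \<in> borel_measurable borel"
        unfolding pd[abs_def] using weighted_derivs_measurable[OF \<phi> d] by simp
    qed
    moreover have "partial_deriv j ?g = (\<lambda>y. phase R (y - v) * ?D y + c * (phase R (y - v) * f y))"
    proof
      fix y
      show "partial_deriv j ?g y = phase R (y - v) * ?D y + c * (phase R (y - v) * f y)"
        unfolding c_def pd by (simp add: algebra_simps)
    qed
    moreover have "(LINT y|lborel. phase R (y - v) * ?D y + c * (phase R (y - v) * f y))
        = phase_transform R ?D v + c * phase_transform R f v"
      unfolding phase_transform_def
        Bochner_Integration.integral_add[OF int[OF D] integrable_mult_right[OF int[OF f]]]
      by simp
    ultimately have "phase_transform R ?D v + c * phase_transform R f v = 0"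
      by (simp only:)
    then have "phase_transform R ?D v = - c * phase_transform R f v"
      by (simp add: eq_neg_iff_add_eq_0)
    then show ?thesis by (simp add: c_def)
  qed
  have "of_real ((R *v v) $ j / 2) * phase_transform R f v = - \<i> * phase_transform R ?D v" for v
    unfolding *[symmetric] by (simp flip: mult.assoc)
  also have "- \<i> * phase_transform R ?D v = phase_transform R (\<lambda>y. - \<i> * ?D y) v" for v
    by (rule phase_transform_scale[symmetric])
  finally show ?thesis
    by (intro that[of "\<lambda>y. - \<i> * ?D y"] weighted_derivs.scale[OF D])
qed

text \<open>
  Two integrations by parts in each coordinate of \<open>K\<close>. The function \<open>g\<close> is independent of \<open>v\<close>, which
  makes the resulting bound uniform.
\<close>

lemma phase_transform_weighted:
  fixes R :: "real ^ 'm ^ 'm"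
  assumes \<phi>: "\<phi> \<in> schwartz" and R: "transpose R = R" and f: "f \<in> weighted_derivs \<phi>"
  shows "\<exists>g \<in> weighted_derivs \<phi>. \<forall>v. of_real (\<Prod>j\<in>K. 1 + ((R *v v) $ j / 2)\<^sup>2) * phase_transform R f v
    = phase_transform R g v"
proof -
  have int: "integrable lborel (\<lambda>y. phase R (y - v) * g y)" if "g \<in> weighted_derivs \<phi>" for g v
    using weighted_derivs_measurable[OF \<phi> that]
    by (intro Bochner_Integration.integrable_bound[OF weighted_derivs_integrable[OF \<phi> that]])
      (auto simp: norm_mult)
  have "finite K" by simp
  then show ?thesis
  proof (induction K rule: finite_induct)
    case empty
    then show ?case using f by (intro bexI[of _ f]) auto
  next
    case (insert j K)
    then obtain g where g: "g \<in> weighted_derivs \<phi>"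
      "\<And>v. of_real (\<Prod>j\<in>K. 1 + ((R *v v) $ j / 2)\<^sup>2) * phase_transform R f v = phase_transform R g v"
      by blast
    obtain g\<^sub>1 where g1: "g\<^sub>1 \<in> weighted_derivs \<phi>"
      "\<And>v. of_real ((R *v v) $ j / 2) * phase_transform R g v = phase_transform R g\<^sub>1 v"
      using phase_transform_by_parts[OF \<phi> R g(1)] by blast
    obtain g\<^sub>2 where g2: "g\<^sub>2 \<in> weighted_derivs \<phi>"
      "\<And>v. of_real ((R *v v) $ j / 2) * phase_transform R g\<^sub>1 v = phase_transform R g\<^sub>2 v"
      using phase_transform_by_parts[OF \<phi> R g1(1)] by blast
    show ?case
    proof (intro bexI allI)
      fix v
      have "of_real (\<Prod>j\<in>insert j K. 1 + ((R *v v) $ j / 2)\<^sup>2) * phase_transform R f v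
          = of_real (1 + ((R *v v) $ j / 2)\<^sup>2) * phase_transform R g v"
        using insert.hyps by (simp add: g(2)[symmetric] mult.assoc)
      also have "\<dots> = phase_transform R g v
          + of_real ((R *v v) $ j / 2) * (of_real ((R *v v) $ j / 2) * phase_transform R g v)"
        by (simp add: algebra_simps power2_eq_square)
      also have "\<dots> = phase_transform R g v + phase_transform R g\<^sub>2 v"
        by (simp only: g1 g2)
      also have "\<dots> = phase_transform R (\<lambda>y. g y + g\<^sub>2 y) v"
        unfolding phase_transform_def distrib_left
        by (rule Bochner_Integration.integral_add[symmetric]) (intro int g g2)+
      finally show "of_real (\<Prod>j\<in>insert j K. 1 + ((R *v v) $ j / 2)\<^sup>2) * phase_transform R f v
          = phase_transform R (\<lambda>y. g y + g\<^sub>2 y) v" .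
    qed (intro weighted_derivs.add g g2)
  qed
qed

lemma borel_measurable_phase_transform:
  assumes f: "f \<in> borel_measurable borel"
  shows "phase_transform R f \<in> borel_measurable borel"
proof -
  note [measurable] = f
  have "(\<lambda>v. LINT y|lborel. phase R (y - v) * f y) \<in> borel_measurable borel"
    by (intro lborel.borel_measurable_lebesgue_integral) measurable
  then show ?thesis by (simp add: phase_transform_def[abs_def])
qed

lemma integrable_phase_transform:
  fixes R :: "real ^ 'm ^ 'm"
  assumes \<phi>: "\<phi> \<in> schwartz" and R: "transpose R = R" and inv: "invertible R"
  shows "integrable lborel (phase_transform R \<phi>)"
proof -
  obtain g where g: "g \<in> weighted_derivs \<phi>"
    "\<And>v. of_real (\<Prod>j\<in>UNIV. 1 + ((R *v v) $ j / 2)\<^sup>2) * phase_transform R \<phi> v = phase_transform R g v"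
    using phase_transform_weighted[OF \<phi> R weighted_derivs_self] by blast
  define C where "C = (LINT y|lborel. norm (g y))"
  have bound: "norm (phase_transform R \<phi> v) \<le> C * cauchy_weight (((1 / 2) *\<^sub>R R) *v v)" for v
  proof -
    let ?P = "\<Prod>j\<in>UNIV. 1 + ((R *v v) $ j / 2)\<^sup>2"
    have P: "?P > 0" by (intro prod_pos) (simp add: add_pos_nonneg)
    have "norm (phase_transform R g v) \<le> (LINT y|lborel. norm (phase R (y - v) * g y))"
      unfolding phase_transform_def by (rule integral_norm_bound)
    then have "?P * norm (phase_transform R \<phi> v) \<le> C"
      using P unfolding g(2)[symmetric] by (simp add: norm_mult C_def del: of_real_prod)
    then have "norm (phase_transform R \<phi> v) \<le> C / ?P"
      using P by (simp add: field_simps)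
    moreover have "cauchy_weight (((1 / 2) *\<^sub>R R) *v v) = inverse ?P"
    proof -
      have "(((1 / 2) *\<^sub>R R) *v v) $ j = (R *v v) $ j / 2" for j
        by (simp add: scaleR_matrix_vector_assoc[symmetric])
      then show ?thesis by (simp only: cauchy_weight_def prod_inversef[symmetric] o_def)
    qed
    ultimately show ?thesis by (simp only: divide_inverse)
  qed
  have inv2: "invertible ((1 / 2) *\<^sub>R R)"
    unfolding invertible_right_inverse
    by (rule exI[of _ "2 *\<^sub>R matrix_inv R"]) (simp add: matrix_scaleR_mult matrix_inv_mult[OF inv])
  have "integrable lborel (cauchy_weight :: real ^ 'm \<Rightarrow> real)"
    by (rule integrable_cauchy_weight)
  then have "integrable lborel (\<lambda>v. C * cauchy_weight (((1 / 2) *\<^sub>R R) *v v))"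
    by (intro integrable_mult_right)
      (simp add: integrable_lborel_matrix[OF inv2 borel_measurable_cauchy_weight])
  then show ?thesis
  proof (rule Bochner_Integration.integrable_bound)
    show "phase_transform R \<phi> \<in> borel_measurable lborel"
      using borel_measurable_phase_transform weighted_derivs_measurable[OF \<phi> weighted_derivs_self] by simp
    show "AE v in lborel. norm (phase_transform R \<phi> v) \<le> norm (C * cauchy_weight (((1 / 2) *\<^sub>R R) *v v))"
      using order_trans[OF bound abs_ge_self] by simp
  qed
qed

section \<open>Convolution of two oscillating Gaussians\<close>

text \<open>
  The exponent that remains after completing the square in \<open>\<langle>P\<^sup>-\<^sup>1v,v\<rangle> + \<langle>A\<^sup>-\<^sup>1(z - v),z - v\<rangle>\<close>. Writing
  \<open>z = (A + P)w\<close>, the critical point is \<open>v = Pw\<close>.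
\<close>

lemma completed_square_identity:
  fixes A P :: "real ^ 'm ^ 'm"
  assumes A: "invertible A" "transpose A = A" and P: "invertible P" and AP: "invertible (A + P)"
    and M: "invertible (matrix_inv P + matrix_inv A)"
  shows "(matrix_inv A *v z) \<bullet> z
      - (matrix_inv (matrix_inv P + matrix_inv A) *v (matrix_inv A *v z)) \<bullet> (matrix_inv A *v z)
    = (matrix_inv (A + P) *v z) \<bullet> z"
proof -
  define w where "w = matrix_inv (A + P) *v z"
  have z: "z = A *v w + P *v w"
    using matrix_inv_mult_vec(1)[OF AP, of z] by (simp add: w_def matrix_vector_mult_add_rdistrib)
  have Az: "matrix_inv A *v z = w + matrix_inv A *v (P *v w)"
    by (simp add: z matrix_vector_right_distrib matrix_inv_mult_vec[OF A(1)])
  then have "(matrix_inv P + matrix_inv A) *v (P *v w) = matrix_inv A *v z"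
    by (simp add: matrix_vector_mult_add_rdistrib matrix_inv_mult_vec[OF P])
  then have "matrix_inv (matrix_inv P + matrix_inv A) *v (matrix_inv A *v z) = P *v w"
    using matrix_inv_mult_vec(2)[OF M] by metis
  then have "(matrix_inv A *v z) \<bullet> z
      - (matrix_inv (matrix_inv P + matrix_inv A) *v (matrix_inv A *v z)) \<bullet> (matrix_inv A *v z)
    = (matrix_inv A *v z) \<bullet> (z - P *v w)"
    by (simp add: inner_diff_right inner_commute)
  also have "z - P *v w = A *v w"
    using z by simp
  also have "(matrix_inv A *v z) \<bullet> (A *v w) = (A *v (matrix_inv A *v z)) \<bullet> w"
    by (metis A(2) inner_mult_vec_transpose)
  also have "\<dots> = w \<bullet> z"
    by (simp add: matrix_inv_mult_vec[OF A(1)] inner_commute)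
  finally show ?thesis by (simp add: w_def)
qed

lemma det_inverse_sum:
  fixes A P :: "real ^ 'm ^ 'm"
  assumes A: "invertible A" and P: "invertible P"
  shows "det A * det (matrix_inv P + matrix_inv A) * det P = det (A + P)"
proof -
  have "A ** (matrix_inv P + matrix_inv A) ** P = A ** (matrix_inv P ** P) + (A ** matrix_inv A) ** P"
    by (simp add: matrix_add_ldistrib matrix_add_rdistrib matrix_mul_assoc)
  also have "\<dots> = A + P"
    by (simp add: matrix_inv_mult[OF A] matrix_inv_mult[OF P])
  finally show ?thesis by (metis det_mul)
qed

text \<open>
  With the damping form \<open>P + A\<close>, here in the role of \<open>P\<^sup>-\<^sup>1 + A\<^sup>-\<^sup>1\<close>, the damping and the quadratic part
  of the phases combine into a single Gaussian whose parameter is \<open>d - i\<close>.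
\<close>

lemma phase_gauss_combine:
  fixes A P :: "real ^ 'm ^ 'm"
  assumes A: "transpose A = A"
  shows "of_real (exp (- d / 4 * (((P + A) *v v) \<bullet> v))) * (phase P v * phase A (z - v))
    = phase A z * gauss_cart (P + A) (- (1 / 2) *\<^sub>R (A *v z)) (of_real d - \<i>) v"
proof -
  have "(A *v (z - v)) \<bullet> (z - v) = (A *v z) \<bullet> z - 2 * ((A *v z) \<bullet> v) + (A *v v) \<bullet> v"
    using inner_mult_vec_symmetric[OF A, of v z]
    by (simp add: matrix_vector_mult_diff_distrib inner_diff_left inner_diff_right)
  then have sq: "complex_of_real ((A *v (z - v)) \<bullet> (z - v))
      = of_real ((A *v z) \<bullet> z) - 2 * of_real ((A *v z) \<bullet> v) + of_real ((A *v v) \<bullet> v)"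
    by simp
  show ?thesis
    unfolding phase_def gauss_cart_def exp_of_real[symmetric] exp_add[symmetric] sq
    by (rule arg_cong[where f = exp])
      (simp add: matrix_vector_mult_add_rdistrib inner_add_left field_simps)
qed

lemma cmod_exp_divide_le_1:
  fixes \<kappa> :: complex
  assumes "Re \<kappa> > 0" "r \<ge> 0"
  shows "norm (exp (- of_real r / \<kappa>)) \<le> 1"
  using assms by (auto simp: Re_divide intro!: divide_nonneg_nonneg)

text \<open>
  Covariances add under convolution. Damping the outer integral by \<open>e\<^bsup>-\<delta>\<langle>Mv,v\<rangle>/4\<^esup>\<close> makes Fubini's theorem
  applicable; the limit \<open>\<delta> \<rightarrow> 0\<close> is dominated on one side by the integrable inner transform and on the
  other side by \<open>|\<phi>|\<close>.
\<close>

lemma phase_convolution: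
  fixes A P :: "real ^ 'm ^ 'm" and \<phi> :: "real ^ 'm \<Rightarrow> complex"
  assumes A: "pos_def A" "transpose A = A" and P: "pos_def P" "transpose P = P"
    and \<phi>: "integrable lborel \<phi>"
    and int: "integrable lborel (phase_transform (matrix_inv A) \<phi>)"
  shows "(LINT v|lborel. phase (matrix_inv P) v * phase_transform (matrix_inv A) \<phi> (v + \<xi>))
    = csqrt (of_real (4 * pi) / (- \<i>)) ^ CARD('m) * of_real (sqrt (det P * det A / det (A + P)))
      * phase_transform (matrix_inv (A + P)) \<phi> \<xi>"
proof -
  define A' where "A' = matrix_inv A"
  define P' where "P' = matrix_inv P"
  define M where "M = P' + A'"
  define \<delta> where "\<delta> n = 1 / real (Suc n)" for n
  define \<kappa> where "\<kappa> n = complex_of_real (\<delta> n) - \<i>" for n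
  define b where "b y = - (1 / 2) *\<^sub>R (A' *v (y - \<xi>))" for y
  define G where "G n = csqrt (of_real (4 * pi) / \<kappa> n) ^ CARD('m) / of_real (sqrt (det M))" for n
  \<comment> \<open>\<open>F n\<close> is the damped integrand of the double integral; \<open>b y\<close> is the frequency in the variable \<open>v\<close>.\<close>
  define F where "F n v y = of_real (exp (- \<delta> n / 4 * ((M *v v) \<bullet> v))) *
      (phase P' v * (phase A' (y - (v + \<xi>)) * \<phi> y))" for n v y
  have \<delta>: "\<delta> n > 0" for n by (simp add: \<delta>_def)
  have \<delta>_lim: "\<delta> \<longlonglongrightarrow> 0" unfolding \<delta>_def by (rule LIMSEQ_Suc[OF lim_1_over_n])
  have Re\<kappa>: "Re (\<kappa> n) > 0" for n using \<delta> by (simp add: \<kappa>_def)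
  have \<kappa>_lim: "\<kappa> \<longlonglongrightarrow> - \<i>"
    unfolding \<kappa>_def using tendsto_diff[OF tendsto_of_real[OF \<delta>_lim] tendsto_const[of \<i>]] by simp
  have invA: "invertible A" and invP: "invertible P" and invAP: "invertible (A + P)"
    using A P pos_def_add pos_def_imp_invertible by blast+
  have symA': "transpose A' = A'" and symP': "transpose P' = P'"
    using A(2) P(2) by (simp_all add: A'_def P'_def transpose_matrix_inv invA invP)
  have M: "pos_def M"
    unfolding M_def A'_def P'_def by (intro pos_def_add pos_def_matrix_inv A P)
  have symM: "transpose M = M"
    using symA' symP' by (simp add: M_def transpose_def vec_eq_iff)
  have invM: "invertible M" by (rule pos_def_imp_invertible[OF M])
  have detM: "det M > 0" by (rule det_pos_def[OF M symM])
  have [measurable]: "\<phi> \<in> borel_measurable borel"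
    using borel_measurable_integrable[OF \<phi>] by simp
  have [measurable]: "phase_transform A' \<phi> \<in> borel_measurable borel"
    by (rule borel_measurable_phase_transform) measurable
  have M_nonneg: "(M *v v) \<bullet> v \<ge> 0" for v
    using M by (cases "v = 0") (auto simp: pos_def_def less_imp_le)
  have damp_le: "exp (- \<delta> n / 4 * ((M *v v) \<bullet> v)) \<le> 1" for n v
    using \<delta>[of n] M_nonneg[of v] by simp

  have lim1: "(\<lambda>n. LINT v|lborel. of_real (exp (- \<delta> n / 4 * ((M *v v) \<bullet> v))) *
        (phase P' v * phase_transform A' \<phi> (v + \<xi>)))
      \<longlonglongrightarrow> (LINT v|lborel. phase P' v * phase_transform A' \<phi> (v + \<xi>))"
  proof (rule integral_dominated_convergence)
    show "integrable lborel (\<lambda>v. norm (phase_transform A' \<phi> (v + \<xi>)))"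
      using int by (intro integrable_norm) (simp add: integrable_lborel_shift A'_def[symmetric])
    show "AE v in lborel. norm (of_real (exp (- \<delta> n / 4 * ((M *v v) \<bullet> v))) *
        (phase P' v * phase_transform A' \<phi> (v + \<xi>))) \<le> norm (phase_transform A' \<phi> (v + \<xi>))" for n
      using damp_le[of n] by (intro AE_I2) (simp add: norm_mult mult_left_le_one_le)
    show "AE v in lborel. (\<lambda>n. of_real (exp (- \<delta> n / 4 * ((M *v v) \<bullet> v))) *
        (phase P' v * phase_transform A' \<phi> (v + \<xi>))) \<longlonglongrightarrow> phase P' v * phase_transform A' \<phi> (v + \<xi>)"
    proof (rule AE_I2)
      fix v
      have "(\<lambda>n. exp (- \<delta> n / 4 * ((M *v v) \<bullet> v))) \<longlonglongrightarrow> exp (- 0 / 4 * ((M *v v) \<bullet> v))"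
        by (intro tendsto_intros \<delta>_lim) simp
      from tendsto_mult[OF tendsto_of_real[OF this] tendsto_const]
      show "(\<lambda>n. of_real (exp (- \<delta> n / 4 * ((M *v v) \<bullet> v))) *
        (phase P' v * phase_transform A' \<phi> (v + \<xi>))) \<longlonglongrightarrow> phase P' v * phase_transform A' \<phi> (v + \<xi>)"
        by simp
    qed
  qed measurable

  have F_eq: "F n v y = (phase A' (y - \<xi>) * \<phi> y) * gauss_cart M (b y) (\<kappa> n) v" for n v y
    using phase_gauss_combine[OF symA', of "\<delta> n" P' v "y - \<xi>"]
    unfolding F_def M_def b_def \<kappa>_def diff_diff_eq[symmetric]
    by (simp add: algebra_simps)
  have inner_v: "(LINT v|lborel. F n v y)
      = G n * (phase A' (y - \<xi>) * exp (- of_real ((matrix_inv M *v b y) \<bullet> b y) / \<kappa> n) * \<phi> y)" for n y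
    unfolding F_eq G_def by (simp add: integral_gauss_cart[OF M symM Re\<kappa>])
  have fubini: "(LINT v|lborel. of_real (exp (- \<delta> n / 4 * ((M *v v) \<bullet> v))) *
        (phase P' v * phase_transform A' \<phi> (v + \<xi>)))
     = G n * (LINT y|lborel. phase A' (y - \<xi>) * exp (- of_real ((matrix_inv M *v b y) \<bullet> b y) / \<kappa> n) * \<phi> y)" for n
  proof -
    have "integrable lborel (gauss_cart M 0 (of_real (\<delta> n)))"
      using \<delta>[of n] by (intro integrable_gauss_cart[OF M symM]) simp
    then have g: "integrable lborel (\<lambda>v. norm (gauss_cart M 0 (of_real (\<delta> n)) v))"
      by (rule integrable_norm)
    have norm_F: "norm (F n v y) = norm (gauss_cart M 0 (of_real (\<delta> n)) v) * norm (\<phi> y)" for v y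
      by (simp add: F_def gauss_cart_def norm_mult)
    have Fm: "case_prod (F n) \<in> borel_measurable (lborel \<Otimes>\<^sub>M lborel)"
      unfolding F_def by measurable
    have F_int: "integrable (lborel \<Otimes>\<^sub>M lborel) (case_prod (F n))"
    proof (rule lborel_pair.Fubini_integrable[OF Fm])
      show "integrable lborel (\<lambda>v. LINT y|lborel. norm (case (v, y) of (v, y) \<Rightarrow> F n v y))"
        using g by (simp add: norm_F)
      show "AE v in lborel. integrable lborel (\<lambda>y. case (v, y) of (v, y) \<Rightarrow> F n v y)"
      proof (rule AE_I2)
        fix v
        have "integrable lborel (\<lambda>y. norm (gauss_cart M 0 (of_real (\<delta> n)) v) * norm (\<phi> y))"
          by (intro integrable_mult_right integrable_norm \<phi>)
        then show "integrable lborel (\<lambda>y. case (v, y) of (v, y) \<Rightarrow> F n v y)"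
          by (rule Bochner_Integration.integrable_bound) (auto simp: norm_F, simp add: F_def)
      qed
    qed
    have "(LINT v|lborel. of_real (exp (- \<delta> n / 4 * ((M *v v) \<bullet> v))) *
        (phase P' v * phase_transform A' \<phi> (v + \<xi>))) = (LINT v|lborel. LINT y|lborel. F n v y)"
      by (simp add: phase_transform_def F_def)
    also have "\<dots> = (LINT y|lborel. LINT v|lborel. F n v y)"
      by (rule lborel_pair.Fubini_integral[OF F_int, symmetric])
    also have "\<dots> = G n * (LINT y|lborel. phase A' (y - \<xi>) * exp (- of_real ((matrix_inv M *v b y) \<bullet> b y) / \<kappa> n) * \<phi> y)"
      unfolding inner_v by simp
    finally show ?thesis .
  qed

  \<comment> \<open>At \<open>\<kappa> = -i\<close> the Gaussian factor is itself a phase, and it completes the square.\<close>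
  have phase_limit: "phase A' (y - \<xi>) * exp (- of_real ((matrix_inv M *v b y) \<bullet> b y) / (- \<i>))
      = phase (matrix_inv (A + P)) (y - \<xi>)" for y
  proof -
    have bb: "(matrix_inv M *v b y) \<bullet> b y = ((matrix_inv M *v (A' *v (y - \<xi>))) \<bullet> (A' *v (y - \<xi>))) / 4"
    proof -
      have *: "(N *v (c *\<^sub>R x)) \<bullet> (c *\<^sub>R x) = c\<^sup>2 * ((N *v x) \<bullet> x)" for N :: "real ^ 'm ^ 'm" and c x
        by (simp add: matrix_vector_mult_scaleR power2_eq_square)
      show ?thesis unfolding b_def * by (simp add: power2_eq_square)
    qed
    have "(A' *v (y - \<xi>)) \<bullet> (y - \<xi>)
        - (matrix_inv M *v (A' *v (y - \<xi>))) \<bullet> (A' *v (y - \<xi>))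
      = (matrix_inv (A + P) *v (y - \<xi>)) \<bullet> (y - \<xi>)"
      using completed_square_identity[OF invA A(2) invP invAP, of "y - \<xi>"] invM
      unfolding M_def A'_def P'_def by blast
    then have eq: "(matrix_inv (A + P) *v (y - \<xi>)) \<bullet> (y - \<xi>)
        = (A' *v (y - \<xi>)) \<bullet> (y - \<xi>) - 4 * ((matrix_inv M *v b y) \<bullet> b y)"
      unfolding bb by simp
    show ?thesis
      unfolding phase_def exp_add[symmetric] eq
      by (intro arg_cong[where f = exp]) (simp add: field_simps)
  qed
  have nonneg: "(matrix_inv M *v x) \<bullet> x \<ge> 0" for x
    using pos_def_matrix_inv[OF M] by (cases "x = 0") (auto simp: pos_def_def less_imp_le)
  have lim2: "(\<lambda>n. LINT y|lborel. phase A' (y - \<xi>) * exp (- of_real ((matrix_inv M *v b y) \<bullet> b y) / \<kappa> n) * \<phi> y)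
      \<longlonglongrightarrow> phase_transform (matrix_inv (A + P)) \<phi> \<xi>"
    unfolding phase_transform_def
  proof (rule integral_dominated_convergence)
    show "integrable lborel (\<lambda>y. norm (\<phi> y))" using \<phi> by (rule integrable_norm)
    show "AE y in lborel. norm (phase A' (y - \<xi>) * exp (- of_real ((matrix_inv M *v b y) \<bullet> b y) / \<kappa> n) * \<phi> y)
        \<le> norm (\<phi> y)" for n
    proof (rule AE_I2)
      fix y
      have "norm (exp (- of_real ((matrix_inv M *v b y) \<bullet> b y) / \<kappa> n)) \<le> 1"
        by (rule cmod_exp_divide_le_1[OF Re\<kappa> nonneg])
      then show "norm (phase A' (y - \<xi>) * exp (- of_real ((matrix_inv M *v b y) \<bullet> b y) / \<kappa> n) * \<phi> y) \<le> norm (\<phi> y)"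
        unfolding norm_mult norm_phase by (simp only: mult_1 mult_left_le_one_le norm_ge_zero)
    qed
    show "AE y in lborel. (\<lambda>n. phase A' (y - \<xi>) * exp (- of_real ((matrix_inv M *v b y) \<bullet> b y) / \<kappa> n) * \<phi> y)
        \<longlonglongrightarrow> phase (matrix_inv (A + P)) (y - \<xi>) * \<phi> y"
    proof (rule AE_I2)
      fix y
      show "(\<lambda>n. phase A' (y - \<xi>) * exp (- of_real ((matrix_inv M *v b y) \<bullet> b y) / \<kappa> n) * \<phi> y)
        \<longlonglongrightarrow> phase (matrix_inv (A + P)) (y - \<xi>) * \<phi> y"
        unfolding phase_limit[symmetric] by (intro tendsto_intros \<kappa>_lim) simp
    qed
    show "(\<lambda>y. phase A' (y - \<xi>) * exp (- of_real ((matrix_inv M *v b y) \<bullet> b y) / \<kappa> n) * \<phi> y) \<in> borel_measurable lborel" for n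
      unfolding b_def by measurable
  qed measurable

  have G_lim: "G \<longlonglongrightarrow> csqrt (of_real (4 * pi) / (- \<i>)) ^ CARD('m) / of_real (sqrt (det M))"
  proof -
    have "isCont csqrt (of_real (4 * pi) / (- \<i>))"
      by (rule continuous_at_csqrt) (simp add: complex_nonpos_Reals_iff)
    then show ?thesis
      unfolding G_def using detM
      by (intro tendsto_intros isCont_tendsto_compose[of _ csqrt] \<kappa>_lim) auto
  qed
  have "(LINT v|lborel. phase P' v * phase_transform A' \<phi> (v + \<xi>))
      = csqrt (of_real (4 * pi) / (- \<i>)) ^ CARD('m) / of_real (sqrt (det M)) * phase_transform (matrix_inv (A + P)) \<phi> \<xi>"
    by (rule LIMSEQ_unique[OF lim1]) (unfold fubini, rule tendsto_mult[OF G_lim lim2])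
  moreover have "complex_of_real (sqrt (det P * det A / det (A + P))) = 1 / of_real (sqrt (det M))"
  proof -
    have "det A \<noteq> 0" "det P \<noteq> 0" using invA invP invertible_det_nz by blast+
    then have "det P * det A / det (A + P) = 1 / det M"
      unfolding det_inverse_sum[OF invA invP, symmetric] M_def A'_def P'_def by simp
    then show ?thesis by (simp add: real_sqrt_divide)
  qed
  ultimately show ?thesis
    unfolding A'_def P'_def by simp
qed

section \<open>The semigroup law\<close>

lemma csqrt_imaginary_axis: "csqrt (of_real (4 * pi) / (- \<i>)) = of_real (sqrt (4 * pi)) * cis (pi / 4)"
proof (rule csqrt_unique)
  show "(of_real (sqrt (4 * pi)) * cis (pi / 4))\<^sup>2 = of_real (4 * pi) / (- \<i>)"
  proof -
    have "(cis (pi / 4))\<^sup>2 = \<i>"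
      by (simp add: Complex.DeMoivre)
    moreover have "(complex_of_real (sqrt (4 * pi)))\<^sup>2 = of_real (4 * pi)"
      by (simp only: of_real_power[symmetric] real_sqrt_pow2[of "4 * pi"]) simp
    ultimately show ?thesis
      by (simp add: power_mult_distrib)
  qed
  show "Re (of_real (sqrt (4 * pi)) * cis (pi / 4)) > 0 \<or>
      Re (of_real (sqrt (4 * pi)) * cis (pi / 4)) = 0 \<and> Im (of_real (sqrt (4 * pi)) * cis (pi / 4)) \<ge> 0"
    by (simp add: cos_45)
qed

text \<open>
  The constant in front of \<open>T(t)\<close> inverts the Fresnel integral \<open>(4\<pi>i)\<^bsup>m/2\<^esup>\<close> that each composition
  produces.
\<close>

lemma normalisation_constant:
  "complex_of_real ((4 * pi) powr (- real m / 2)) * exp (- (\<i> * complex_of_real pi * of_nat m / 4))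
    * csqrt (of_real (4 * pi) / (- \<i>)) ^ m = 1"
proof -
  have "(4 * pi) powr (- real m / 2) * sqrt (4 * pi) ^ m = 1"
    by (simp add: powr_half_sqrt[symmetric] powr_realpow[symmetric] powr_powr powr_add[symmetric])
  then have "complex_of_real ((4 * pi) powr (- real m / 2)) * of_real (sqrt (4 * pi)) ^ m = 1"
    by (metis of_real_1 of_real_mult of_real_power)
  moreover have "exp (- (\<i> * complex_of_real pi * of_nat m / 4)) * cis (pi / 4) ^ m = 1"
    by (simp add: cis_conv_exp exp_of_nat_mult[symmetric] exp_add[symmetric])
  ultimately show ?thesis
    unfolding csqrt_imaginary_axis power_mult_distrib by (metis (no_types, lifting) mult.assoc mult.left_commute mult_1)
qed

lemma T_op_eq_phase_transform:
  fixes Q B :: "real ^ 'm ^ 'm"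
  shows "T_op Q B t \<phi> x =
     complex_of_real ((4 * pi) powr (- real CARD('m) / 2)) * exp (- (\<i> * complex_of_real pi * of_nat CARD('m) / 4))
     / complex_of_real (sqrt (det (Qt Q B t)))
     * phase_transform (matrix_inv (Qt Q B t)) \<phi> (matrix_exp (t *\<^sub>R B) *v x)"
  unfolding T_op_def phase_transform_def phase_def by simp

theorem proposition2p7:
  fixes Q B :: "real ^ 'm ^ 'm"
  assumes "Q = transpose Q"
    and "pos_semidef Q"
    and "\<And>t. t > 0 \<Longrightarrow> pos_def (Qt Q B t)"
  shows "\<forall>\<phi> \<in> schwartz. \<forall>s > 0. \<forall>t > 0. T_op Q B (s + t) \<phi> = T_op Q B s (T_op Q B t \<phi>)"
proof (intro ballI allI impI ext)
  fix \<phi> :: "real ^ 'm \<Rightarrow> complex" and s t :: real and x :: "real ^ 'm"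
  assume \<phi>: "\<phi> \<in> schwartz" and s: "s > 0" and t: "t > 0"
  define A where "A = Qt Q B t"
  define P\<^sub>0 where "P\<^sub>0 = Qt Q B s"
  define E where "E = matrix_exp (t *\<^sub>R B)"
  define F where "F = matrix_exp (s *\<^sub>R B)"
  define P where "P = E ** P\<^sub>0 ** transpose E"
  define \<xi> where "\<xi> = E *v (F *v x)"
  define K where "K = complex_of_real ((4 * pi) powr (- real CARD('m) / 2))
      * exp (- (\<i> * complex_of_real pi * of_nat CARD('m) / 4))"
  define u where "u = phase_transform (matrix_inv A) \<phi>"
  have E: "invertible E" unfolding E_def by (rule invertible_matrix_exp)
  have A: "pos_def A" "transpose A = A" and P0: "pos_def P\<^sub>0" "transpose P\<^sub>0 = P\<^sub>0"
    using assms s t by (simp_all add: A_def P\<^sub>0_def Qt_symmetric)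
  have invA: "invertible A" and invP0: "invertible P\<^sub>0"
    using A P0 pos_def_imp_invertible by blast+
  have P: "pos_def P" "transpose P = P"
    unfolding P_def
    by (rule pos_def_congruence[OF P0(1) E], simp add: matrix_transpose_mul P0 matrix_mul_assoc)
  have AP: "Qt Q B (s + t) = A + P"
    using s t by (simp add: Qt_add A_def P_def P\<^sub>0_def E_def)
  have EF: "matrix_exp ((s + t) *\<^sub>R B) *v x = \<xi>"
    by (simp add: \<xi>_def E_def F_def matrix_vector_mul_assoc matrix_exp_add[symmetric] add.commute)
  have A': "transpose (matrix_inv A) = matrix_inv A" "invertible (matrix_inv A)"
    using A(2) invA by (simp_all add: transpose_matrix_inv pos_def_imp_invertible pos_def_matrix_inv A(1))
  have u_int: "integrable lborel u"
    unfolding u_def by (rule integrable_phase_transform[OF \<phi> A'])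
  have [measurable]: "u \<in> borel_measurable borel"
    using borel_measurable_integrable[OF u_int] by simp
  have \<phi>_int: "integrable lborel \<phi>"
    by (rule weighted_derivs_integrable[OF \<phi> weighted_derivs_self])

  have T_t: "T_op Q B t \<phi> = (\<lambda>z. K / of_real (sqrt (det A)) * u (E *v z))"
    by (simp add: fun_eq_iff T_op_eq_phase_transform K_def u_def A_def E_def)
  \<comment> \<open>Substituting \<open>v = E (z - Fx)\<close> in the outer integral turns \<open>P\<^sub>0\<close> into \<open>P\<close>.\<close>
  have "phase_transform (matrix_inv P\<^sub>0) (\<lambda>z. u (E *v z)) (F *v x)
      = (LINT z|lborel. phase (matrix_inv P\<^sub>0) (z + F *v x - F *v x) * u (E *v (z + F *v x)))"
    unfolding phase_transform_def
    by (subst integral_lborel_shift[of "\<lambda>z. phase (matrix_inv P\<^sub>0) (z - F *v x) * u (E *v z)"]) simp_all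
  also have "\<dots> = (LINT z|lborel. phase (matrix_inv P) (E *v z) * u (E *v z + \<xi>))"
    by (simp add: phase_def P_def matrix_inv_congruence[OF E invP0] \<xi>_def matrix_vector_right_distrib)
  also have "\<dots> = (1 / \<bar>det E\<bar>) *\<^sub>R (LINT v|lborel. phase (matrix_inv P) v * u (v + \<xi>))"
    using E integral_lborel_matrix[OF E, of "\<lambda>v. phase (matrix_inv P) v * u (v + \<xi>)"]
    by (simp add: invertible_det_nz)
  also have "(LINT v|lborel. phase (matrix_inv P) v * u (v + \<xi>))
      = csqrt (of_real (4 * pi) / (- \<i>)) ^ CARD('m) * of_real (sqrt (det P * det A / det (A + P)))
        * phase_transform (matrix_inv (A + P)) \<phi> \<xi>"
    unfolding u_def by (rule phase_convolution[OF A P \<phi>_int u_int[unfolded u_def]])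
  finally have inner: "phase_transform (matrix_inv P\<^sub>0) (\<lambda>z. u (E *v z)) (F *v x)
      = of_real (sqrt (det P * det A / det (A + P)) / \<bar>det E\<bar>) * csqrt (of_real (4 * pi) / (- \<i>)) ^ CARD('m)
        * phase_transform (matrix_inv (A + P)) \<phi> \<xi>"
    by (simp add: scaleR_conv_of_real)

  have dets: "sqrt (det P * det A / det (A + P)) / \<bar>det E\<bar> = sqrt (det P\<^sub>0) * sqrt (det A) / sqrt (det (A + P))"
  proof -
    have "det P * det A / det (A + P) = (det E)\<^sup>2 * (det P\<^sub>0 * det A / det (A + P))"
      by (simp add: P_def det_mul power2_eq_square)
    then have "sqrt (det P * det A / det (A + P)) = \<bar>det E\<bar> * (sqrt (det P\<^sub>0) * sqrt (det A) / sqrt (det (A + P)))"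
      by (simp only: real_sqrt_mult real_sqrt_divide real_sqrt_abs)
    then show ?thesis using E by (simp add: invertible_det_nz)
  qed
  have pos: "det P\<^sub>0 > 0" "det A > 0"
    using det_pos_def[OF A] det_pos_def[OF P0] by blast+
  have K: "K * csqrt (of_real (4 * pi) / (- \<i>)) ^ CARD('m) = 1"
    unfolding K_def by (rule normalisation_constant)

  have "T_op Q B s (T_op Q B t \<phi>) x
      = K / of_real (sqrt (det P\<^sub>0)) * (K / of_real (sqrt (det A)) *
          phase_transform (matrix_inv P\<^sub>0) (\<lambda>z. u (E *v z)) (F *v x))"
    unfolding T_t T_op_eq_phase_transform[of Q B s] phase_transform_scale
    by (simp add: K_def P\<^sub>0_def F_def)
  also have "\<dots> = (K * csqrt (of_real (4 * pi) / (- \<i>)) ^ CARD('m)) * (K / of_real (sqrt (det (A + P))))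
      * phase_transform (matrix_inv (A + P)) \<phi> \<xi>"
    unfolding inner dets using pos by simp
  also have "\<dots> = T_op Q B (s + t) \<phi> x"
    unfolding K T_op_eq_phase_transform[of Q B "s + t"] AP EF by (simp add: K_def)
  finally show "T_op Q B (s + t) \<phi> x = T_op Q B s (T_op Q B t \<phi>) x" ..
qed

end
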